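(* The polar degree is lower semi-continuous in deformations of fixed degree $d$. More precisely, let $f_s$ ($s\in\mathbb{C}$ near $0$) be a deformation of the homogeneous polynomial $f_0:=f$ on $\mathbb{C}^{n+1}$ by homogeneous polynomials of constant degree $d$, and let $V_s:=\{f_s=0\}\subset\mathbb{P}^n$, $V:=V_0$. Then $\mathrm{pol}(V_s)\ge \mathrm{pol}(V)$ for all $s\in\mathbb{C}$ close enough to $0$.
   Context: Everything is over $\mathbb{C}$. For a hypersurface $V=\{f=0\}\subset\mathbb{P}^n$ defined by a homogeneous polynomial $f$ of degree $d$, $\mathrm{Sing}(V)$ is the set of points where all partial derivatives of $f$ vanish, and the polar degree $\mathrm{pol}(V)$ is the topological degree of the gradient map $\mathrm{grad} f:\mathbb{P}^{n}\setminus \mathrm{Sing}(V)\to \mathbb{P}^{n}$, i.e. the number of preimages of a general point (it equals $0$ when the map is not dominant). No assumption is made on the dimension of the singular locus, and $\mathrm{pol}(V)=0$ is allowed. A deformation $f_s$ of constant degree is a family of homogeneous polynomials of degree $d$ whose coefficients depend holomorphically on $s$. *)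

theory Defs
  imports "HOL-Complex_Analysis.Complex_Analysis" "HOL-Library.Poly_Mapping"
begin

text \<open>
  Coordinates on \<open>\<complex>\<^sup>n\<^sup>+\<^sup>1\<close> are indexed by a finite type \<open>'n\<close>, so \<open>n + 1 = CARD('n)\<close>.
  A polynomial maps each exponent \<open>'n \<Rightarrow>\<^sub>0 nat\<close> to its coefficient.
\<close>

type_synonym 'n cpoly = "('n \<Rightarrow>\<^sub>0 nat) \<Rightarrow>\<^sub>0 complex"

definition cpoly_eval :: "'n::finite cpoly \<Rightarrow> complex ^ 'n \<Rightarrow> complex" where
  "cpoly_eval f x =
     (\<Sum>m\<in>Poly_Mapping.keys f. Poly_Mapping.lookup f m * (\<Prod>i\<in>UNIV. x $ i ^ Poly_Mapping.lookup m i))"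

text \<open>The zero polynomial is homogeneous of every degree.\<close>

definition homogeneous :: "nat \<Rightarrow> 'n::finite cpoly \<Rightarrow> bool" where
  "homogeneous d f \<longleftrightarrow> (\<forall>m\<in>Poly_Mapping.keys f. (\<Sum>i\<in>UNIV. Poly_Mapping.lookup m i) = d)"

definition gradient :: "'n::finite cpoly \<Rightarrow> complex ^ 'n \<Rightarrow> complex ^ 'n" where
  "gradient f x = (\<chi> i. deriv (\<lambda>t. cpoly_eval f (x + axis i t)) 0)"

text \<open>
  A point of the projective space is a complex line through the origin; \<open>vec.span\<close> is the span over
  the field of the entries, here the complex numbers.
\<close>

definition proj_space :: "(complex ^ 'n::finite) set set" where
  "proj_space = {vec.span {x} |x. x \<noteq> 0}"

definition zariski_open :: "(complex ^ 'n::finite) set set \<Rightarrow> bool" where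
  "zariski_open U \<longleftrightarrow>
     (\<exists>S. (\<forall>g\<in>S. \<exists>e. homogeneous e g) \<and>
          U = proj_space - {p \<in> proj_space. \<forall>g\<in>S. \<forall>x\<in>p. cpoly_eval g x = 0})"

definition for_general_point :: "((complex ^ 'n::finite) set \<Rightarrow> bool) \<Rightarrow> bool" where
  "for_general_point P \<longleftrightarrow> (\<exists>U. zariski_open U \<and> U \<noteq> {} \<and> (\<forall>p\<in>U. P p))"

text \<open>The origin is excluded because linear forms have a constant gradient.\<close>

definition Sing :: "'n::finite cpoly \<Rightarrow> (complex ^ 'n) set set" where
  "Sing f = {p \<in> proj_space. \<forall>x\<in>p. x \<noteq> 0 \<longrightarrow> gradient f x = 0}"

text \<open>
  For homogeneous \<open>f\<close> the gradients at the points of a line \<open>p\<close> outside \<open>Sing f\<close> are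
  proportional and not all zero, so their span is again a line: \<open>[x]\<close> goes to \<open>[gradient f x]\<close>.
\<close>

definition grad_map :: "'n::finite cpoly \<Rightarrow> (complex ^ 'n) set \<Rightarrow> (complex ^ 'n) set" where
  "grad_map f p = vec.span (gradient f ` p)"

definition grad_fibre :: "'n::finite cpoly \<Rightarrow> (complex ^ 'n) set \<Rightarrow> (complex ^ 'n) set set" where
  "grad_fibre f q = {p \<in> proj_space - Sing f. grad_map f p = q}"

text \<open>If the gradient map is not dominant, the general fibre is empty and the value is 0.\<close>

definition polar_degree :: "'n::finite cpoly \<Rightarrow> nat" where
  "polar_degree f =
     (THE k. for_general_point (\<lambda>q. finite (grad_fibre f q) \<and> card (grad_fibre f q) = k))"

end

theory Submission
  imports Defs
begin

text \<open>
  Write \<open>G = gradient f\<close>, a polynomial map of \<open>\<complex>\<^sup>N\<close> to itself. Unless its image lies in a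
  hypersurface, every coordinate function and the Jacobian determinant are algebraic over
  \<open>\<complex>(G)\<close>. Away from the zeros of the leading coefficients of the minimal equations of the
  coordinates, \<open>G\<close> is proper; away from the zeros of the constant coefficient of the minimal
  equation of the determinant, it is unramified. So outside a hypersurface \<open>G\<close> is a finite covering
  and, the complement of a hypersurface being connected, the fibre cardinality is constant. This
  shows that the polar degree is well defined and is attained by a fibre consisting of
  nondegenerate points. By the open mapping property of \<open>(s, x) \<mapsto> (s, gradient (f s) x)\<close> at each of
  them, the fibre persists for all nearby \<open>s\<close> and all nearby values, hence over some general point.
\<close>

text \<open>Only an inequality can be expected: for \<open>s\<close> away from 0, further points of
  the fibre may enter from the singular locus of \<open>f 0\<close>, so the proof follows only the
  points already present. The values that are general for \<open>f s\<close> vary with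
  \<open>s\<close>, and a fixed value \<open>y\<close> may fail to be general for some
  \<open>s\<close> arbitrarily near 0. The points are therefore followed over a whole neighbourhood
  of \<open>y\<close> that does not depend on \<open>s\<close>; it contains general values of every
  \<open>f s\<close>, because a hypersurface contains no ball. Counting takes place in affine space,
  where derivatives and compactness are at hand. For degree \<open>Suc e\<close> with
  \<open>e > 0\<close>, each line of a projective fibre carries exactly \<open>e\<close> vectors
  with a prescribed gradient, so the affine count is \<open>e\<close> times the projective one. This
  correspondence fails for \<open>e = 0\<close>, where the gradient is constant; degrees 0 and 1 are
  settled by direct computation. In degree 1 the value 1 occurs only when projective space is a
  single point.\<close>

no_notation fps_nth (infixl \<open>$\<close> 75)

section \<open>Polynomial functions\<close>

text \<open>Functions instead of formal terms: closure under composition, determinants and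
  differentiation then follows by rule induction, and non-homogeneous equations in the target space
  are included.\<close>

inductive polyfun :: "(complex ^ 'n::finite \<Rightarrow> complex) \<Rightarrow> bool" where
  const: "polyfun (\<lambda>_. c)"
| coord: "polyfun (\<lambda>x. x $ i)"
| add: "polyfun p \<Longrightarrow> polyfun q \<Longrightarrow> polyfun (\<lambda>x. p x + q x)"
| mult: "polyfun p \<Longrightarrow> polyfun q \<Longrightarrow> polyfun (\<lambda>x. p x * q x)"

lemma polyfun_sum:
  "(\<And>i. i \<in> I \<Longrightarrow> polyfun (p i)) \<Longrightarrow> polyfun (\<lambda>x. \<Sum>i\<in>I. p i x)"
  by (induction I rule: infinite_finite_induct) (auto intro: polyfun.intros)

lemma polyfun_prod:
  "(\<And>i. i \<in> I \<Longrightarrow> polyfun (p i)) \<Longrightarrow> polyfun (\<lambda>x. \<Prod>i\<in>I. p i x)"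
  by (induction I rule: infinite_finite_induct) (auto intro: polyfun.intros)

lemma polyfun_power: "polyfun p \<Longrightarrow> polyfun (\<lambda>x. p x ^ k)"
  by (induction k) (auto intro: polyfun.intros)

lemmas polyfun_intros = polyfun.intros polyfun_sum polyfun_prod polyfun_power

lemma polyfun_compose:
  assumes "polyfun p" and "\<And>i. polyfun (\<lambda>x. G x $ i)"
  shows "polyfun (\<lambda>x. p (G x))"
  using assms by (induction p) (auto intro: polyfun.intros)

lemma polyfun_det:
  assumes "\<And>i j. polyfun (\<lambda>x. A x $ i $ j)"
  shows "polyfun (\<lambda>x. det (A x :: complex ^ 'n ^ 'n))"
  unfolding det_def by (intro polyfun_intros assms)

lemma polyfun_line:
  assumes "polyfun p"
  shows "\<exists>u. \<forall>t. p (a + t *s b) = poly u t"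
  using assms
proof (induction p)
  case (const c)
  show ?case by (rule exI[of _ "[:c:]"]) simp
next
  case (coord i)
  show ?case by (rule exI[of _ "[:a $ i, b $ i:]"]) simp
next
  case (add p q)
  then obtain u v where "\<forall>t. p (a + t *s b) = poly u t" "\<forall>t. q (a + t *s b) = poly v t" by blast
  then show ?case by (intro exI[of _ "u + v"]) simp
next
  case (mult p q)
  then obtain u v where "\<forall>t. p (a + t *s b) = poly u t" "\<forall>t. q (a + t *s b) = poly v t" by blast
  then show ?case by (intro exI[of _ "u * v"]) simp
qed

lemma polyfun_zeros_on_line_finite:
  assumes "polyfun p" and "p (a + t0 *s b) \<noteq> 0"
  shows "finite {t. p (a + t *s b) = 0}"
proof -
  obtain u where u: "\<forall>t. p (a + t *s b) = poly u t"
    using polyfun_line[OF assms(1)] by blast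
  then have "u \<noteq> 0" using assms(2) by auto
  then show ?thesis using u poly_roots_finite by simp
qed

text \<open>On the line through \<open>a\<close> and \<open>b\<close> each of the two functions has
  finitely many zeros, so some parameter avoids them all. In this form the absence of zero divisors
  is used throughout.\<close>

lemma polyfun_mult_nonzero:
  assumes p: "polyfun p" "p a \<noteq> 0" and q: "polyfun q" "q b \<noteq> 0"
  obtains x where "p x \<noteq> 0" "q x \<noteq> 0"
proof -
  have "finite {t. p (a + t *s (b - a)) = 0}"
    by (rule polyfun_zeros_on_line_finite[where ?t0.0 = 0]) (use p in auto)
  moreover have "finite {t. q (a + t *s (b - a)) = 0}"
    by (rule polyfun_zeros_on_line_finite[where ?t0.0 = 1]) (use q in auto)
  ultimately have "finite ({t. p (a + t *s (b - a)) = 0} \<union> {t. q (a + t *s (b - a)) = 0})"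
    by simp
  then obtain t where "t \<notin> {t. p (a + t *s (b - a)) = 0} \<union> {t. q (a + t *s (b - a)) = 0}"
    using ex_new_if_finite[OF infinite_UNIV_char_0] by blast
  then show ?thesis using that by auto
qed

lemma polyfun_prod_nonzero:
  assumes "finite I" and "\<And>i. i \<in> I \<Longrightarrow> polyfun (p i)" and "\<And>i. i \<in> I \<Longrightarrow> \<exists>x. p i x \<noteq> 0"
  shows "\<exists>x. \<forall>i\<in>I. p i x \<noteq> 0"
  using assms
proof (induction I)
  case (insert i I)
  then obtain x where "\<forall>i\<in>I. p i x \<noteq> 0" by auto
  then have "(\<lambda>x. \<Prod>i\<in>I. p i x) x \<noteq> 0" using insert.hyps by simp
  moreover have "polyfun (\<lambda>x. \<Prod>i\<in>I. p i x)" using insert.prems by (auto intro: polyfun_prod)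
  moreover obtain y where "p i y \<noteq> 0" using insert.prems by blast
  ultimately obtain w where "(\<Prod>i\<in>I. p i w) \<noteq> 0" "p i w \<noteq> 0"
    using polyfun_mult_nonzero[of "\<lambda>x. \<Prod>i\<in>I. p i x" x "p i" y] insert.prems(1) by auto
  then show ?case using insert.hyps by auto
qed auto

lemma continuous_vector_line:
  fixes a b :: "complex ^ 'n::finite"
  shows "continuous_on S (\<lambda>t. a + t *s b)"
  unfolding vec_eq_iff vector_scalar_mult_def by (intro continuous_intros)

text \<open>Along the line from \<open>b\<close> to \<open>a\<close> only finitely many parameters
  give zeros of \<open>p\<close>, while infinitely many lead into \<open>W\<close>: nonempty open
  sets of the usual topology are Zariski dense.\<close>

lemma polyfun_nonzero_open:
  assumes p: "polyfun p" "p a \<noteq> 0" and "open W" "b \<in> W"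
  obtains x where "x \<in> W" "p x \<noteq> 0"
proof -
  let ?l = "\<lambda>t. b + t *s (a - b)"
  have "open (?l -` W)"
    using continuous_vector_line \<open>open W\<close> by (rule open_vimage[OF _ , rotated])
  moreover have "0 \<in> ?l -` W" using \<open>b \<in> W\<close> by simp
  ultimately have "infinite (?l -` W)"
    by (metis empty_iff finite_imp_not_open)
  moreover have "finite {t. p (?l t) = 0}"
    by (rule polyfun_zeros_on_line_finite[where ?t0.0 = 1]) (use p in auto)
  ultimately obtain t where "t \<in> ?l -` W" "t \<notin> {t. p (?l t) = 0}"
    by (meson finite_subset subsetI)
  then show ?thesis using that by auto
qed

section \<open>Complex partial derivatives of polynomial functions\<close>

lemma bounded_linear_axis: "bounded_linear (axis i :: complex \<Rightarrow> complex ^ 'n::finite)"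
  by (auto simp: linear_conv_bounded_linear[symmetric] linear_iff axis_def vec_eq_iff)

definition partial :: "'n \<Rightarrow> (complex ^ 'n::finite \<Rightarrow> complex) \<Rightarrow> complex ^ 'n \<Rightarrow> complex" where
  "partial i p x = deriv (\<lambda>t. p (x + axis i t)) 0"

text \<open>\<open>has_derivative\<close> is real differentiation; the sum formula records that the
  derivative is complex linear. The coefficients stay existential during the induction and are
  identified with \<open>partial\<close> afterwards, by \<open>partial_eqI\<close>.\<close>

lemma polyfun_has_derivative_ex:
  assumes "polyfun (p :: complex ^ 'n::finite \<Rightarrow> complex)"
  shows "\<exists>q. (\<forall>i. polyfun (q i)) \<and>
           (\<forall>x. (p has_derivative (\<lambda>h. \<Sum>i\<in>UNIV. q i x * h $ i)) (at x))"
  using assms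
proof (induction p)
  case (const c)
  show ?case by (intro exI[of _ "\<lambda>_ _. 0"] conjI allI polyfun.const) simp
next
  case (coord i)
  have "((\<lambda>x. x $ i) has_derivative (\<lambda>h. \<Sum>j\<in>UNIV. (if j = i then 1 else 0) * h $ j)) (at x)"
    for x :: "complex ^ 'n"
    using bounded_linear_imp_has_derivative[OF bounded_linear_vec_nth]
    by (simp add: if_distrib[of "\<lambda>c. c * _"] cong: if_cong)
  then show ?case
    by (intro exI[of _ "\<lambda>j _. if j = i then 1 else 0"] conjI allI polyfun.const)
next
  case (add p q)
  then obtain u v where "\<forall>i. polyfun (u i)" "\<forall>i. polyfun (v i)"
    "\<And>x. (p has_derivative (\<lambda>h. \<Sum>i\<in>UNIV. u i x * h $ i)) (at x)"
    "\<And>x. (q has_derivative (\<lambda>h. \<Sum>i\<in>UNIV. v i x * h $ i)) (at x)" by auto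
  moreover have "((\<lambda>x. p x + q x) has_derivative
      (\<lambda>h. \<Sum>i\<in>UNIV. (u i x + v i x) * h $ i)) (at x)" for x
    by (rule has_derivative_eq_rhs[OF has_derivative_add[OF calculation(3,4)]])
      (simp add: fun_eq_iff sum.distrib algebra_simps)
  ultimately show ?case
    by (intro exI[of _ "\<lambda>i x. u i x + v i x"] conjI allI polyfun.intros) auto
next
  case (mult p q)
  then obtain u v where "\<forall>i. polyfun (u i)" "\<forall>i. polyfun (v i)"
    "\<And>x. (p has_derivative (\<lambda>h. \<Sum>i\<in>UNIV. u i x * h $ i)) (at x)"
    "\<And>x. (q has_derivative (\<lambda>h. \<Sum>i\<in>UNIV. v i x * h $ i)) (at x)" by auto
  moreover have "((\<lambda>x. p x * q x) has_derivative
      (\<lambda>h. \<Sum>i\<in>UNIV. (p x * v i x + u i x * q x) * h $ i)) (at x)" for x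
    by (rule has_derivative_eq_rhs[OF has_derivative_mult[OF calculation(3,4)]])
      (simp_all add: fun_eq_iff sum.distrib algebra_simps sum_distrib_left)
  ultimately show ?case using mult.hyps
    by (intro exI[of _ "\<lambda>i x. p x * v i x + u i x * q x"] conjI allI polyfun.intros) auto
qed

lemma partial_eqI:
  assumes "(p has_derivative (\<lambda>h. \<Sum>j\<in>UNIV. q j * h $ j)) (at x)"
  shows "partial i p x = q i"
proof -
  have axis_zero: "x + axis i 0 = x" by (simp add: axis_def zero_vec_def[symmetric])
  have "((\<lambda>t::complex. x + axis i t) has_derivative (\<lambda>t. axis i t)) (at 0)"
    using bounded_linear_imp_has_derivative[OF bounded_linear_axis, of i "at 0"]
    by (auto intro!: derivative_eq_intros)
  then have "((\<lambda>t. p (x + axis i t)) has_derivative (\<lambda>t. \<Sum>j\<in>UNIV. q j * axis i t $ j)) (at 0)"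
    by (rule has_derivative_compose) (simp add: axis_zero assms)
  also have "(\<lambda>t. \<Sum>j\<in>UNIV. q j * axis i t $ j) = (*) (q i)"
    by (auto simp: axis_def if_distrib[of "\<lambda>c. _ * c"] cong: if_cong)
  finally show ?thesis
    unfolding partial_def by (intro DERIV_imp_deriv) (simp add: has_field_derivative_def)
qed

lemma
  assumes "polyfun p"
  shows polyfun_partial: "polyfun (partial i p)"
    and polyfun_has_derivative:
      "(p has_derivative (\<lambda>h. \<Sum>i\<in>UNIV. partial i p x * h $ i)) (at x)"
proof -
  obtain q where q: "\<And>i. polyfun (q i)"
    and D: "\<And>x. (p has_derivative (\<lambda>h. \<Sum>i\<in>UNIV. q i x * h $ i)) (at x)"
    using polyfun_has_derivative_ex[OF assms] by blast
  then have "partial i p = q i" for i by (intro ext partial_eqI)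
  then show "polyfun (partial i p)" "(p has_derivative (\<lambda>h. \<Sum>i\<in>UNIV. partial i p x * h $ i)) (at x)"
    using q D by simp_all
qed

lemma polyfun_continuous: "polyfun p \<Longrightarrow> continuous_on S p"
  by (meson continuous_at_imp_continuous_on has_derivative_continuous polyfun_has_derivative)

section \<open>Algebraic dependence\<close>

text \<open>Exponents are plain functions here, so that finite product sets of them can be counted;
  \<open>bij_betw_lookup\<close> translates to the exponents of \<open>cpoly\<close>.\<close>

definition monom_fun :: "('n \<Rightarrow> nat) \<Rightarrow> complex ^ 'n::finite \<Rightarrow> complex" where
  "monom_fun \<alpha> x = (\<Prod>i\<in>UNIV. x $ i ^ \<alpha> i)"

lemma polyfun_monom: "polyfun (monom_fun \<alpha>)"
  unfolding monom_fun_def by (intro polyfun_intros)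

lemma monom_fun_add: "monom_fun (\<lambda>i. \<alpha> i + \<beta> i) x = monom_fun \<alpha> x * monom_fun \<beta> x"
  by (simp add: monom_fun_def power_add prod.distrib)

lemma monom_fun_scale: "monom_fun \<alpha> (t *s x) = t ^ (\<Sum>i\<in>UNIV. \<alpha> i) * monom_fun \<alpha> x"
  by (simp add: monom_fun_def power_mult_distrib prod.distrib power_sum)

lemma monom_fun_mult_arg: "monom_fun \<alpha> (\<chi> i. x $ i * y $ i) = monom_fun \<alpha> x * monom_fun \<alpha> y"
  by (simp add: monom_fun_def power_mult_distrib prod.distrib)

lemma monom_fun_separate:
  assumes "\<alpha> \<noteq> \<beta>"
  obtains y where "monom_fun \<alpha> y \<noteq> monom_fun \<beta> y"
proof -
  obtain i where i: "\<alpha> i \<noteq> \<beta> i" using assms by auto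
  let ?y = "\<chi> j. if j = i then (2::complex) else 1"
  have "monom_fun \<gamma> ?y = 2 ^ \<gamma> i" for \<gamma>
    by (simp add: monom_fun_def if_distrib[of "\<lambda>c. c ^ _"] cong: if_cong)
  moreover have "(2::complex) ^ \<alpha> i \<noteq> 2 ^ \<beta> i"
  proof
    assume "(2::complex) ^ \<alpha> i = 2 ^ \<beta> i"
    then have "norm ((2::complex) ^ \<alpha> i) = norm ((2::complex) ^ \<beta> i)" by simp
    with i show False by (simp add: norm_power)
  qed
  ultimately show ?thesis using that[of ?y] by metis
qed

text \<open>Monomials are multiplicative characters, so Artin's argument for the independence of
  characters applies.\<close>

lemma monom_fun_independent:
  assumes "finite M" and "\<And>x. (\<Sum>\<alpha>\<in>M. c \<alpha> * monom_fun \<alpha> (x :: complex ^ 'n::finite)) = 0"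
    and "\<alpha> \<in> M"
  shows "c \<alpha> = 0"
  using assms
proof (induction M arbitrary: c \<alpha> rule: finite_induct)
  case (insert \<beta> M)
  have rest: "c \<gamma> = 0" if "\<gamma> \<in> M" for \<gamma>
  proof -
    have "\<gamma> \<noteq> \<beta>" using that insert.hyps by auto
    then obtain y :: "complex ^ 'n" where y: "monom_fun \<gamma> y \<noteq> monom_fun \<beta> y"
      by (rule monom_fun_separate)
    have "(\<Sum>\<alpha>\<in>M. c \<alpha> * (monom_fun \<alpha> y - monom_fun \<beta> y) * monom_fun \<alpha> x) = 0" for x
    proof -
      have "(\<Sum>\<alpha>\<in>insert \<beta> M. c \<alpha> * monom_fun \<alpha> (\<chi> i. y $ i * x $ i))
        - monom_fun \<beta> y * (\<Sum>\<alpha>\<in>insert \<beta> M. c \<alpha> * monom_fun \<alpha> x) = 0"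
        using insert.prems(1) by simp
      then show ?thesis
        using insert.hyps
        by (simp add: monom_fun_mult_arg sum_distrib_left sum_subtractf algebra_simps)
    qed
    then have "c \<gamma> * (monom_fun \<gamma> y - monom_fun \<beta> y) = 0"
      using insert.IH[of "\<lambda>\<alpha>. c \<alpha> * (monom_fun \<alpha> y - monom_fun \<beta> y)" \<gamma>] that by simp
    then show ?thesis using y by simp
  qed
  moreover have "c \<beta> = 0"
    using insert.prems(1)[of "\<chi> i. 1"] rest insert.hyps by (simp add: monom_fun_def)
  ultimately show ?case using insert.prems(2) by auto
qed auto

section \<open>Spans of monomials with bounded exponents\<close>

definition exponent_box :: "nat \<Rightarrow> ('n \<Rightarrow> nat) set" where
  "exponent_box k = UNIV \<rightarrow>\<^sub>E {..k}"

lemma mem_exponent_box: "\<alpha> \<in> exponent_box k \<longleftrightarrow> (\<forall>i. \<alpha> i \<le> k)"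
  by (auto simp: exponent_box_def)

lemma finite_exponent_box [simp]: "finite (exponent_box k :: ('n::finite \<Rightarrow> nat) set)"
  unfolding exponent_box_def by (intro finite_PiE) auto

lemma card_exponent_box: "card (exponent_box k :: ('n::finite \<Rightarrow> nat) set) = Suc k ^ CARD('n)"
  unfolding exponent_box_def by (subst card_PiE) auto

text \<open>The linear span of the monomials in the box, built one term at a time so that sums and
  products go by rule induction. Bounding each exponent separately, instead of the total degree,
  makes the number of monomials an exact power.\<close>

inductive box_span :: "nat \<Rightarrow> (complex ^ 'n::finite \<Rightarrow> complex) \<Rightarrow> bool" for k where
  zero: "box_span k (\<lambda>_. 0)"
| step: "box_span k p \<Longrightarrow> \<alpha> \<in> exponent_box k \<Longrightarrow> box_span k (\<lambda>x. p x + c * monom_fun \<alpha> x)"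

lemma box_span_mono: "box_span k p \<Longrightarrow> k \<le> l \<Longrightarrow> box_span l p"
proof (induction rule: box_span.induct)
  case (step p \<alpha> c)
  then have "\<alpha> \<in> exponent_box l" unfolding mem_exponent_box by (meson le_trans)
  with step show ?case by (intro box_span.step) auto
qed (rule box_span.zero)

lemma box_span_add:
  assumes "box_span k p" and "box_span k q"
  shows "box_span k (\<lambda>x. p x + q x)"
  using assms(2,1)
proof (induction rule: box_span.induct)
  case (step q \<alpha> c)
  then have "box_span k (\<lambda>x. (p x + q x) + c * monom_fun \<alpha> x)" by (intro box_span.step) auto
  then show ?case by (simp add: add.assoc)
qed simp

lemma box_span_scale:
  assumes "box_span k p" and "\<beta> \<in> exponent_box l"
  shows "box_span (k + l) (\<lambda>x. p x * (c * monom_fun \<beta> x))"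
  using assms
proof (induction rule: box_span.induct)
  case zero
  then show ?case by (simp add: box_span.zero)
next
  case (step p \<alpha> b)
  then have "(\<lambda>i. \<alpha> i + \<beta> i) \<in> exponent_box (k + l)" by (simp add: mem_exponent_box add_mono)
  with step have "box_span (k + l) (\<lambda>x. p x * (c * monom_fun \<beta> x)
      + (b * c) * monom_fun (\<lambda>i. \<alpha> i + \<beta> i) x)"
    by (intro box_span.step) auto
  then show ?case by (simp add: monom_fun_add algebra_simps)
qed

lemma box_span_mult:
  assumes "box_span k p" and "box_span l q"
  shows "box_span (k + l) (\<lambda>x. p x * q x)"
  using assms(2,1)
proof (induction rule: box_span.induct)
  case zero
  then show ?case by (simp add: box_span.zero)
next
  case (step q \<alpha> b)
  then have "box_span (k + l) (\<lambda>x. p x * q x + p x * (b * monom_fun \<alpha> x))"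
    by (intro box_span_add box_span_scale) auto
  then show ?case by (simp add: algebra_simps)
qed

lemma box_span_monom: "\<alpha> \<in> exponent_box k \<Longrightarrow> box_span k (monom_fun \<alpha>)"
  using box_span.step[OF box_span.zero, of \<alpha> k 1] by simp

lemma box_span_const: "box_span k (\<lambda>_. c)"
  using box_span.step[OF box_span.zero, of "\<lambda>_. 0" k c] by (simp add: mem_exponent_box monom_fun_def)

lemma box_span_power: "box_span k p \<Longrightarrow> box_span (j * k) (\<lambda>x. p x ^ j)"
  by (induction j) (simp_all add: box_span_const box_span_mult)

lemma box_span_prod:
  assumes "finite I" and "\<And>i. i \<in> I \<Longrightarrow> box_span k (p i)"
  shows "box_span (card I * k) (\<lambda>x. \<Prod>i\<in>I. p i x)"
  using assms by (induction I) (simp_all add: box_span_const box_span_mult)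

lemma polyfun_box_span:
  assumes "polyfun (p :: complex ^ 'n::finite \<Rightarrow> complex)"
  shows "\<exists>k. box_span k p"
  using assms
proof (induction p)
  case (const c)
  show ?case using box_span_const by blast
next
  case (coord i)
  have "monom_fun (\<lambda>j. if j = i then 1 else 0) = (\<lambda>x :: complex ^ 'n. x $ i)"
    by (simp add: fun_eq_iff monom_fun_def if_distrib[of "\<lambda>c. _ ^ c"] cong: if_cong)
  then show ?case
    using box_span_monom[of "\<lambda>j. if j = i then 1 else 0" 1]
    by (auto simp: mem_exponent_box intro!: exI[of _ "Suc 0"])
next
  case (add p q)
  then obtain k l where "box_span k p" "box_span l q" by blast
  then have "box_span (max k l) p" "box_span (max k l) q" by (auto intro: box_span_mono)
  then show ?case using box_span_add by blast
next
  case (mult p q)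
  then show ?case using box_span_mult by blast
qed

lemma box_span_explicit:
  assumes "box_span k p"
  shows "\<exists>a. \<forall>x. p x = (\<Sum>\<alpha>\<in>exponent_box k. a \<alpha> * monom_fun \<alpha> x)"
  using assms
proof (induction rule: box_span.induct)
  case zero
  show ?case by (rule exI[of _ "\<lambda>_. 0"]) simp
next
  case (step p \<alpha> c)
  then obtain a where "\<forall>x. p x = (\<Sum>\<alpha>\<in>exponent_box k. a \<alpha> * monom_fun \<alpha> x)" by blast
  with step.hyps show ?case
    by (intro exI[of _ "\<lambda>\<beta>. a \<beta> + (if \<beta> = \<alpha> then c else 0)"])
      (simp add: distrib_right sum.distrib if_distrib[of "\<lambda>c. c * _"] cong: if_cong)
qed

text \<open>Gaussian elimination by induction on the equations: an unknown \<open>j\<close>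
  occurring in equation \<open>b\<close> is eliminated from the others, which leaves one equation
  and one unknown fewer.\<close>

lemma homogeneous_linear_system:
  fixes A :: "'i \<Rightarrow> 'b \<Rightarrow> complex"
  assumes "finite B" and "finite I" and "card B < card I"
  shows "\<exists>a. (\<exists>i\<in>I. a i \<noteq> 0) \<and> (\<forall>b\<in>B. (\<Sum>i\<in>I. a i * A i b) = 0)"
  using assms
proof (induction B arbitrary: I A rule: finite_induct)
  case empty
  then have "I \<noteq> {}" by auto
  then show ?case by (intro exI[of _ "\<lambda>_. 1"]) auto
next
  case (insert b B)
  show ?case
  proof (cases "\<forall>i\<in>I. A i b = 0")
    case True
    from insert have "card B < card I" by simp
    then obtain a where "\<exists>i\<in>I. a i \<noteq> 0" "\<forall>b\<in>B. (\<Sum>i\<in>I. a i * A i b) = 0"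
      using insert.IH[OF insert.prems(1)] by blast
    then show ?thesis using True by (intro exI[of _ a]) auto
  next
    case False
    then obtain j where j: "j \<in> I" "A j b \<noteq> 0" by blast
    define J where "J = I - {j}"
    have J: "finite J" "j \<notin> J" "I = insert j J" using insert.prems(1) j by (auto simp: J_def)
    then have "card B < card J" using insert.prems(2) insert.hyps by simp
    then obtain a where a: "\<exists>i\<in>J. a i \<noteq> 0"
      "\<forall>c\<in>B. (\<Sum>i\<in>J. a i * (A i c - A i b / A j b * A j c)) = 0"
      using insert.IH[OF J(1), of "\<lambda>i c. A i c - A i b / A j b * A j c"] by blast
    \<comment> \<open>The value of the unknown \<open>j\<close> that equation \<open>b\<close>
      forces.\<close>
    define r where "r = - (\<Sum>i\<in>J. a i * A i b) / A j b"
    define a' where "a' = a(j := r)"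
    have sum: "(\<Sum>i\<in>I. a' i * A i c) = r * A j c + (\<Sum>i\<in>J. a i * A i c)" for c
    proof -
      have "(\<Sum>i\<in>J. a' i * A i c) = (\<Sum>i\<in>J. a i * A i c)"
        using J by (intro sum.cong) (auto simp: a'_def)
      then show ?thesis using J by (simp add: a'_def)
    qed
    have "(\<Sum>i\<in>I. a' i * A i c) = 0" if "c \<in> insert b B" for c
    proof (cases "c = b")
      case True
      then show ?thesis unfolding sum using j by (simp add: r_def)
    next
      case False
      with that a(2) have "(\<Sum>i\<in>J. a i * (A i c - A i b / A j b * A j c)) = 0" by auto
      moreover have "(\<Sum>i\<in>J. a i * (A i c - A i b / A j b * A j c))
          = (\<Sum>i\<in>J. a i * A i c) + r * A j c"
        using j by (simp add: r_def sum_subtractf right_diff_distrib sum_distrib_right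
            sum_divide_distrib mult.assoc)
      ultimately show ?thesis unfolding sum by (simp only: add.commute)
    qed
    moreover have "\<exists>i\<in>I. a' i \<noteq> 0" using a(1) J by (auto simp: a'_def)
    ultimately show ?thesis by blast
  qed
qed

text \<open>Counting: the products \<open>G\<^sup>\<alpha> p\<^sup>j\<close> with all exponents at most \<open>m\<close> number
  \<open>(m + 1)\<^sup>N\<^sup>+\<^sup>1\<close>, but lie in a space whose dimension grows only like \<open>m\<^sup>N\<close>.\<close>

lemma algebraic_relation:
  fixes G :: "complex ^ 'n::finite \<Rightarrow> complex ^ 'n"
  assumes G: "\<And>i. polyfun (\<lambda>x. G x $ i)" and p: "polyfun p"
  obtains n c where "\<And>j. polyfun (c j)" and "\<exists>y. c n y \<noteq> 0"
    and "\<And>x. (\<Sum>j\<le>n. c j (G x) * p x ^ j) = 0"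
proof -
  define N where "N = CARD('n)"
  have "\<exists>k. box_span k (\<lambda>x. G x $ i)" for i using polyfun_box_span[OF G] .
  then obtain g where g: "\<And>i. box_span (g i) (\<lambda>x. G x $ i)" by metis
  obtain k where k: "box_span k p" using polyfun_box_span[OF p] ..
  define E where "E = Max (insert k (range g))"
  have "g i \<le> E" "k \<le> E" for i
    unfolding E_def by (rule Max_ge; simp)+
  then have E: "\<And>i. box_span E (\<lambda>x. G x $ i)" "box_span E p"
    using box_span_mono[OF g] box_span_mono[OF k] by auto
  \<comment> \<open>The \<open>N\<close> powers of components of \<open>G\<close> and the power of
    \<open>p\<close> each lie in the span for the bound \<open>m * E\<close>; together they need the
    bound \<open>F * m\<close>.\<close>
  define F where "F = Suc N * E"
  \<comment> \<open>Chosen so that \<open>(F * m + 1) ^ N \<le> (F + 1) ^ N * (m + 1) ^ N = m * (m +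
    1) ^ N\<close>, which is less than the number \<open>(m + 1) ^ (N + 1)\<close> of
    products.\<close>
  define m where "m = Suc F ^ N"
  define I :: "(('n \<Rightarrow> nat) \<times> nat) set" where "I = exponent_box m \<times> {..m}"
  have span: "box_span (F * m) (\<lambda>x. monom_fun \<alpha> (G x) * p x ^ j)"
    if "(\<alpha>, j) \<in> I" for \<alpha> j
  proof -
    have "box_span (m * E) (\<lambda>x. G x $ i ^ \<alpha> i)" for i
      using that by (intro box_span_mono[OF box_span_power[OF E(1)]]) (auto simp: I_def mem_exponent_box)
    then have "box_span (N * (m * E)) (\<lambda>x. monom_fun \<alpha> (G x))"
      unfolding monom_fun_def N_def by (intro box_span_prod) auto
    moreover have "box_span (m * E) (\<lambda>x. p x ^ j)"
      using that by (intro box_span_mono[OF box_span_power[OF E(2)]]) (auto simp: I_def)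
    ultimately have "box_span (N * (m * E) + m * E) (\<lambda>x. monom_fun \<alpha> (G x) * p x ^ j)"
      by (rule box_span_mult)
    moreover have "N * (m * E) + m * E = F * m" by (simp add: F_def algebra_simps)
    ultimately show ?thesis by simp
  qed
  have "\<exists>a. \<forall>x. monom_fun (fst i) (G x) * p x ^ snd i
      = (\<Sum>\<beta>\<in>exponent_box (F * m). a \<beta> * monom_fun \<beta> x)" if "i \<in> I" for i
    using box_span_explicit[OF span[of "fst i" "snd i"]] that by simp
  then obtain A where A: "\<And>i x. i \<in> I \<Longrightarrow> monom_fun (fst i) (G x) * p x ^ snd i
      = (\<Sum>\<beta>\<in>exponent_box (F * m). A i \<beta> * monom_fun \<beta> x)" by metis
  have "Suc (F * m) \<le> Suc F * Suc m" by simp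
  then have "Suc (F * m) ^ N \<le> (Suc F * Suc m) ^ N" by (rule power_mono) simp
  also have "\<dots> = m * Suc m ^ N" by (simp only: power_mult_distrib m_def)
  also have "\<dots> < Suc m ^ N * Suc m" by simp
  finally have "card (exponent_box (F * m) :: ('n \<Rightarrow> nat) set) < card I"
    by (simp add: I_def card_exponent_box card_cartesian_product N_def)
  then obtain a where a: "\<exists>i\<in>I. a i \<noteq> 0"
    "\<forall>\<beta>\<in>exponent_box (F * m). (\<Sum>i\<in>I. a i * A i \<beta>) = 0"
    using homogeneous_linear_system[of "exponent_box (F * m) :: ('n \<Rightarrow> nat) set" I A]
    by (auto simp: I_def)
  define c where "c j y = (\<Sum>\<alpha>\<in>exponent_box m. a (\<alpha>, j) * monom_fun \<alpha> y)" for j and y :: "complex ^ 'n"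
  have c: "polyfun (c j)" for j
    unfolding c_def by (intro polyfun_intros polyfun_monom)
  have rel: "(\<Sum>j\<le>m. c j (G x) * p x ^ j) = 0" for x
  proof -
    have "(\<Sum>j\<le>m. c j (G x) * p x ^ j)
        = (\<Sum>j\<le>m. \<Sum>\<alpha>\<in>exponent_box m. a (\<alpha>, j) * (monom_fun \<alpha> (G x) * p x ^ j))"
      by (simp add: c_def sum_distrib_right mult.assoc)
    also have "\<dots> = (\<Sum>i\<in>I. a i * (monom_fun (fst i) (G x) * p x ^ snd i))"
      unfolding I_def by (subst sum.swap) (simp add: sum.cartesian_product case_prod_unfold)
    also have "\<dots> = (\<Sum>i\<in>I. \<Sum>\<beta>\<in>exponent_box (F * m). a i * A i \<beta> * monom_fun \<beta> x)"
      by (intro sum.cong) (auto simp: A sum_distrib_left mult.assoc)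
    also have "\<dots> = (\<Sum>\<beta>\<in>exponent_box (F * m). (\<Sum>i\<in>I. a i * A i \<beta>) * monom_fun \<beta> x)"
      by (subst sum.swap) (simp add: sum_distrib_right)
    also have "\<dots> = 0" using a(2) by simp
    finally show ?thesis .
  qed
  \<comment> \<open>Identically vanishing coefficients are dropped from the top, so that the last
    one kept is a nonzero polynomial. Independence of the monomials guarantees that one is
    left.\<close>
  define S where "S = {j. j \<le> m \<and> (\<exists>y. c j y \<noteq> 0)}"
  obtain \<alpha> j where \<alpha>j: "\<alpha> \<in> exponent_box m" "j \<le> m" "a (\<alpha>, j) \<noteq> 0"
    using a(1) by (auto simp: I_def)
  then have "\<exists>y. c j y \<noteq> 0"
    unfolding c_def using monom_fun_independent[where M = "exponent_box m" and c = "\<lambda>\<alpha>. a (\<alpha>, j)"]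
    by (metis finite_exponent_box)
  then have "j \<in> S" using \<alpha>j by (simp add: S_def)
  have "finite S" by (simp add: S_def)
  define n where "n = Max S"
  have "n \<in> S" using \<open>j \<in> S\<close> \<open>finite S\<close> Max_in unfolding n_def by blast
  have "(\<Sum>j\<le>n. c j (G x) * p x ^ j) = 0" for x
  proof -
    have "c j y = 0" if "j \<in> {..m} - {..n}" for j y
    proof -
      have "j \<notin> S" using that Max_ge[OF \<open>finite S\<close>, of j] by (auto simp: n_def)
      then show ?thesis using that by (simp add: S_def)
    qed
    then have "(\<Sum>j\<le>m. c j (G x) * p x ^ j) = (\<Sum>j\<le>n. c j (G x) * p x ^ j)"
      using \<open>n \<in> S\<close> by (intro sum.mono_neutral_right) (auto simp: S_def)
    then show ?thesis using rel by simp
  qed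
  then show ?thesis using that[of c n] c \<open>n \<in> S\<close> by (auto simp: S_def)
qed

section \<open>Minimal relations and the Jacobian\<close>

text \<open>An equation for \<open>p\<close> over the field generated by the components of
  \<open>G\<close>, with denominators cleared. The leading coefficient is nonzero as a polynomial on
  the target, not along the image of \<open>G\<close>; so \<open>n = 0\<close> is possible precisely
  when the components of \<open>G\<close> are algebraically dependent.\<close>

definition alg_rel ::
    "(complex ^ 'n::finite \<Rightarrow> complex ^ 'n) \<Rightarrow> (complex ^ 'n \<Rightarrow> complex) \<Rightarrow>
      nat \<Rightarrow> (nat \<Rightarrow> complex ^ 'n \<Rightarrow> complex) \<Rightarrow> bool" where
  "alg_rel G p n c \<longleftrightarrow> (\<forall>j. polyfun (c j)) \<and> (\<exists>y. c n y \<noteq> 0) \<and>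
     (\<forall>x. (\<Sum>j\<le>n. c j (G x) * p x ^ j) = 0)"

text \<open>Minimality of the degree stands in for irreducibility of a minimal polynomial: it is
  contradicted below by constructing relations of degree one less.\<close>

definition min_rel ::
    "(complex ^ 'n::finite \<Rightarrow> complex ^ 'n) \<Rightarrow> (complex ^ 'n \<Rightarrow> complex) \<Rightarrow>
      nat \<Rightarrow> (nat \<Rightarrow> complex ^ 'n \<Rightarrow> complex) \<Rightarrow> bool" where
  "min_rel G p n c \<longleftrightarrow> alg_rel G p n c \<and> (\<forall>k<n. \<forall>c'. \<not> alg_rel G p k c')"

lemma min_rel_exists:
  assumes "\<And>i. polyfun (\<lambda>x. G x $ i)" and "polyfun p"
  shows "\<exists>n c. min_rel G p n c"
proof -
  obtain n c where "alg_rel G p n c"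
    using algebraic_relation[OF assms] unfolding alg_rel_def by metis
  then have "\<exists>n. \<exists>c. alg_rel G p n c" by blast
  then obtain c' where "alg_rel G p (LEAST n. \<exists>c. alg_rel G p n c) c'"
    using LeastI_ex[of "\<lambda>n. \<exists>c. alg_rel G p n c"] by blast
  then show ?thesis
    unfolding min_rel_def using not_less_Least[of _ "\<lambda>n. \<exists>c. alg_rel G p n c"] by blast
qed

definition jacobian :: "(complex ^ 'n::finite \<Rightarrow> complex ^ 'n) \<Rightarrow> complex ^ 'n \<Rightarrow> complex ^ 'n ^ 'n" where
  "jacobian G x = (\<chi> i j. partial j (\<lambda>x. G x $ i) x)"

lemma has_derivative_cart:
  fixes G :: "'a::real_normed_vector \<Rightarrow> complex ^ 'n::finite"
  assumes "\<And>i. ((\<lambda>x. G x $ i) has_derivative (\<lambda>h. G' h $ i)) (at x)"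
  shows "(G has_derivative G') (at x)"
proof -
  have expand: "v = (\<Sum>i\<in>UNIV. axis i (v $ i))" for v :: "complex ^ 'n"
    by (simp add: vec_eq_iff axis_def)
  have "((\<lambda>x. \<Sum>i\<in>UNIV. axis i (G x $ i) :: complex ^ 'n) has_derivative
      (\<lambda>h. \<Sum>i\<in>UNIV. axis i (G' h $ i))) (at x)"
    by (intro has_derivative_sum bounded_linear.has_derivative[OF bounded_linear_axis] assms)
  then show ?thesis by (simp add: expand[symmetric])
qed

lemma bounded_linear_matrix_vector_mult:
  "bounded_linear ((*v) (A :: complex ^ 'n::finite ^ 'm::finite))"
  by (simp add: linear_conv_bounded_linear[symmetric] linear_iff vec_eq_iff
      matrix_vector_mult_def scaleR_sum_right distrib_left sum.distrib)

context
  fixes G :: "complex ^ 'n::finite \<Rightarrow> complex ^ 'n"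
  assumes G: "\<And>i. polyfun (\<lambda>x. G x $ i)"
begin

lemma polyfun_jacobian: "polyfun (\<lambda>x. jacobian G x $ i $ j)"
  by (simp add: jacobian_def polyfun_partial[OF G])

lemma polyfun_det_jacobian: "polyfun (\<lambda>x. det (jacobian G x))"
  by (intro polyfun_det polyfun_jacobian)

lemma has_derivative_jacobian: "(G has_derivative (\<lambda>h. jacobian G x *v h)) (at x)"
  by (rule has_derivative_cart)
    (simp add: jacobian_def matrix_vector_mult_def polyfun_has_derivative[OF G])

lemma continuous_on_polynomial_map: "continuous_on S G"
  by (meson continuous_at_imp_continuous_on has_derivative_continuous has_derivative_jacobian)

text \<open>The injectivity half of the inverse function theorem. Continuity of the derivative in
  operator norm comes from continuity of the matrix entries, whose norms sum to a bound for the
  operator norm.\<close>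

lemma jacobian_locally_injective:
  assumes "det (jacobian G a) \<noteq> 0"
  obtains r where "r > 0" "inj_on G (ball a r)"
proof -
  obtain B where B: "B ** jacobian G a = mat 1"
    using assms by (auto simp: invertible_det_nz[symmetric] invertible_def)
  have onorm_matrix: "onorm ((*v) A) \<le> (\<Sum>i\<in>UNIV. \<Sum>j\<in>UNIV. norm (A $ i $ j))"
    for A :: "complex ^ 'n ^ 'n"
  proof (rule onorm_le)
    fix v :: "complex ^ 'n"
    have "norm (A *v v) \<le> (\<Sum>i\<in>UNIV. norm ((A *v v) $ i))"
      unfolding norm_vec_def by (rule L2_set_le_sum) simp
    also have "\<dots> \<le> (\<Sum>i\<in>UNIV. \<Sum>j\<in>UNIV. norm (A $ i $ j) * norm v)"
      unfolding matrix_vector_mult_def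
      by (auto intro!: sum_mono order_trans[OF norm_sum] mult_left_mono Finite_Cartesian_Product.norm_nth_le
          simp: norm_mult)
    also have "\<dots> = (\<Sum>i\<in>UNIV. \<Sum>j\<in>UNIV. norm (A $ i $ j)) * norm v"
      by (simp add: sum_distrib_right)
    finally show "norm (A *v v) \<le> \<dots>" .
  qed
  have "\<exists>d>0. \<forall>x. dist a x < d \<longrightarrow> onorm (\<lambda>v. jacobian G x *v v - jacobian G a *v v) < e"
    if "e > 0" for e
  proof -
    define s where
      "s x = (\<Sum>i\<in>UNIV. \<Sum>j\<in>UNIV. norm ((jacobian G x - jacobian G a) $ i $ j))" for x
    have "continuous_on UNIV s"
      unfolding s_def vector_minus_component
      by (intro continuous_intros polyfun_continuous polyfun_jacobian)
    then have "\<exists>d>0. \<forall>x. dist x a < d \<longrightarrow> dist (s x) (s a) < e"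
      using that by (auto simp: continuous_on_iff)
    then obtain d where d: "d > 0" "\<And>x. dist x a < d \<Longrightarrow> dist (s x) (s a) < e" by blast
    have "onorm (\<lambda>v. jacobian G x *v v - jacobian G a *v v) < e" if "dist a x < d" for x
    proof -
      have "s a = 0" by (simp add: s_def)
      then have "s x < e" using d(2)[of x] that by (simp add: dist_commute)
      then show ?thesis
        using onorm_matrix[of "jacobian G x - jacobian G a"]
        unfolding s_def matrix_vector_mult_diff_rdistrib by linarith
    qed
    then show ?thesis using d(1) by blast
  qed
  then have cont: "\<And>e. e > 0 \<Longrightarrow> \<exists>d>0. \<forall>x. dist a x < d \<longrightarrow>
      onorm (\<lambda>v. jacobian G x *v v - jacobian G a *v v) < e" .
  have left_inv: "(*v) B \<circ> (*v) (jacobian G a) = id"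
    by (simp add: fun_eq_iff matrix_vector_mul_assoc B)
  show ?thesis
    by (rule has_derivative_locally_injective[OF UNIV_I[of a] open_UNIV
          bounded_linear_matrix_vector_mult left_inv has_derivative_jacobian cont])
      (assumption, rule that)
qed

text \<open>The inverse matrix is a right inverse of the derivative at \<open>a\<close>, as
  Sussmann's open mapping theorem requires.\<close>

lemma jacobian_open_at:
  assumes "det (jacobian G a) \<noteq> 0" and "r > 0"
  shows "G a \<in> interior (G ` ball a r)"
proof -
  obtain B where "jacobian G a ** B = mat 1"
    using assms by (auto simp: invertible_det_nz[symmetric] invertible_def)
  then have "(\<lambda>h. jacobian G a *v h) \<circ> (*v) B = id"
    by (simp add: fun_eq_iff matrix_vector_mul_assoc)
  then show ?thesis
    using assms(2)
    by (intro sussmann_open_mapping[OF open_UNIV continuous_on_polynomial_map UNIV_I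
          has_derivative_jacobian bounded_linear_matrix_vector_mult]) auto
qed

context
  assumes indep: "\<forall>r. polyfun r \<longrightarrow> (\<forall>x. r (G x) = 0) \<longrightarrow> (\<forall>y. r y = 0)"
begin

text \<open>A relation of degree 0 is a nonzero polynomial vanishing on the image of
  \<open>G\<close>; \<open>indep\<close> says that the components of \<open>G\<close> are
  algebraically independent.\<close>

lemma min_rel_degree_pos:
  assumes "alg_rel G p n c"
  shows "n \<noteq> 0"
proof
  assume "n = 0"
  then have "polyfun (c 0)" "\<And>x. c 0 (G x) = 0" "\<exists>y. c 0 y \<noteq> 0"
    using assms by (auto simp: alg_rel_def)
  then show False using indep by blast
qed

text \<open>If the formal derivative vanished along \<open>G\<close> and \<open>p\<close>, it would
  be a relation of degree \<open>n - 1\<close>: its leading coefficient is \<open>n\<close> times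
  the old one, hence nonzero in characteristic 0.\<close>

lemma min_rel_separable:
  assumes "min_rel G p n c"
  shows "\<exists>x. (\<Sum>j\<le>n. c j (G x) * (of_nat j * p x ^ (j - 1))) \<noteq> 0"
proof (rule ccontr)
  assume *: "\<nexists>x. (\<Sum>j\<le>n. c j (G x) * (of_nat j * p x ^ (j - 1))) \<noteq> 0"
  obtain k where n: "n = Suc k"
    using min_rel_degree_pos assms not0_implies_Suc unfolding min_rel_def by blast
  have "alg_rel G p k (\<lambda>j y. of_nat (Suc j) * c (Suc j) y)"
    using assms * unfolding min_rel_def alg_rel_def n
    by (auto simp: sum.atMost_Suc_shift mult_ac simp del: sum.atMost_Suc of_nat_Suc
        intro!: polyfun_intros)
  then show False using assms by (auto simp: min_rel_def n)
qed

text \<open>With zero constant coefficient the relation is \<open>p\<close> times a shorter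
  expression. As \<open>p\<close> is not the zero function and there are no zero divisors, that
  expression vanishes identically, against minimality.\<close>

lemma min_rel_const_coeff:
  assumes "min_rel G p n c" and "polyfun p" and "p a \<noteq> 0"
  shows "\<exists>y. c 0 y \<noteq> 0"
proof (rule ccontr)
  assume *: "\<nexists>y. c 0 y \<noteq> 0"
  obtain k where n: "n = Suc k"
    using min_rel_degree_pos assms not0_implies_Suc unfolding min_rel_def by blast
  let ?q = "\<lambda>x. \<Sum>j\<le>k. c (Suc j) (G x) * p x ^ j"
  have c: "\<And>j. polyfun (c j)" using assms by (auto simp: min_rel_def alg_rel_def)
  have prod: "p x * ?q x = 0" for x
  proof -
    have "(\<Sum>j\<le>n. c j (G x) * p x ^ j) = 0" using assms by (auto simp: min_rel_def alg_rel_def)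
    then show ?thesis using *
      by (simp add: n sum.atMost_Suc_shift sum_distrib_left mult_ac del: sum.atMost_Suc)
  qed
  have "polyfun (\<lambda>x. c j (G x))" for j by (rule polyfun_compose[OF c G])
  then have q: "polyfun ?q" by (intro polyfun_intros assms)
  have "?q x = 0" for x
  proof (rule ccontr)
    assume "?q x \<noteq> 0"
    then obtain w where "p w \<noteq> 0" "?q w \<noteq> 0"
      using polyfun_mult_nonzero[OF assms(2,3) q, of x] by blast
    then show False using prod[of w] by simp
  qed
  then have "alg_rel G p k (\<lambda>j. c (Suc j))"
    using assms(1) c by (auto simp: min_rel_def alg_rel_def n)
  then show False using assms by (auto simp: min_rel_def n)
qed

text \<open>Differentiating the minimal relations of the coordinates shows that the kernel of the
  Jacobian is trivial wherever these relations are separable.\<close>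

lemma det_jacobian_nonzero: "\<exists>x. det (jacobian G x) \<noteq> 0"
proof -
  have "\<exists>n c. min_rel G (\<lambda>x. x $ i) n c" for i
    by (intro min_rel_exists G polyfun.coord)
  then obtain n c where nc: "\<And>i. min_rel G (\<lambda>x. x $ i) (n i) (c i)" by metis
  then have c: "polyfun (c i j)" for i j by (auto simp: min_rel_def alg_rel_def)
  let ?s = "\<lambda>i x. \<Sum>j\<le>n i. c i j (G x) * (of_nat j * x $ i ^ (j - 1))"
  have "\<exists>x. \<forall>i\<in>UNIV. ?s i x \<noteq> 0"
  proof (rule polyfun_prod_nonzero)
    have "polyfun (\<lambda>x. c i j (G x))" for i j by (rule polyfun_compose[OF c G])
    then show "polyfun (?s i)" for i by (intro polyfun_intros)
    show "\<exists>x. ?s i x \<noteq> 0" for i using min_rel_separable[OF nc] .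
  qed simp
  then obtain x where x: "\<And>i. ?s i x \<noteq> 0" by blast
  have "h = 0" if ker: "jacobian G x *v h = 0" for h
  proof -
    have "h $ i = 0" for i
    proof -
      have dc: "((\<lambda>x. c i j (G x)) has_derivative
          (\<lambda>h. \<Sum>l\<in>UNIV. partial l (c i j) (G x) * (jacobian G x *v h) $ l)) (at x)" for j
        using has_derivative_compose[OF has_derivative_jacobian polyfun_has_derivative[OF c]] .
      have "((\<lambda>x. x $ i ^ j) has_derivative (\<lambda>h. of_nat j * h $ i * x $ i ^ (j - 1))) (at x)"
        for j :: nat
        by (rule has_derivative_power)
          (rule bounded_linear_imp_has_derivative[OF bounded_linear_vec_nth])
      then have D: "((\<lambda>x. \<Sum>j\<le>n i. c i j (G x) * x $ i ^ j) has_derivative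
          (\<lambda>h. \<Sum>j\<le>n i. c i j (G x) * (of_nat j * h $ i * x $ i ^ (j - 1)) +
            (\<Sum>l\<in>UNIV. partial l (c i j) (G x) * (jacobian G x *v h) $ l) * x $ i ^ j)) (at x)"
        by (intro has_derivative_sum has_derivative_mult dc)
      have zero: "(\<lambda>x. \<Sum>j\<le>n i. c i j (G x) * x $ i ^ j) = (\<lambda>_. 0)"
        using nc[of i] by (auto simp: min_rel_def alg_rel_def)
      \<comment> \<open>Along a kernel vector \<open>h\<close> the coefficients
        \<open>c i j (G x)\<close> have derivative zero, so only the derivative in the unknown
        \<open>x $ i\<close> survives.\<close>
      from fun_cong[OF has_derivative_unique[OF D[unfolded zero] has_derivative_const], of h]
      have "?s i x * h $ i = 0"
        by (simp add: ker sum_distrib_left sum_distrib_right mult_ac)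
      then show ?thesis using x[of i] by simp
    qed
    then show ?thesis by (simp add: vec_eq_iff)
  qed
  then have "\<exists>B. B ** jacobian G x = mat 1" by (simp add: matrix_left_invertible_ker)
  then show ?thesis using invertible_left_inverse invertible_det_nz by blast
qed

end

end

section \<open>Fibres of polynomial maps\<close>

text \<open>Cauchy's bound for roots. The \<open>max 1\<close> covers small \<open>t\<close>, for
  which lower powers are not dominated by \<open>norm t ^ (n - 1)\<close>.\<close>

lemma root_bound:
  fixes t :: complex
  assumes "(\<Sum>j\<le>n. c j * t ^ j) = 0" and "c n \<noteq> 0"
  shows "norm t \<le> max 1 ((\<Sum>j<n. norm (c j)) / norm (c n))"
proof (cases "norm t \<le> 1")
  case False
  then have t: "norm t \<ge> 1" by simp
  have n: "n \<noteq> 0" using assms by (intro notI) simp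
  have "(\<Sum>j<n. c j * t ^ j) + c n * t ^ n = 0"
    using assms(1) by (simp add: lessThan_Suc_atMost[symmetric])
  then have "c n * t ^ n = - (\<Sum>j<n. c j * t ^ j)" by (simp add: eq_neg_iff_add_eq_0 add.commute)
  then have "norm (c n) * norm t ^ n = norm (\<Sum>j<n. c j * t ^ j)"
    by (metis norm_minus_cancel norm_mult norm_power)
  also have "\<dots> \<le> (\<Sum>j<n. norm (c j) * norm t ^ j)"
    by (rule order_trans[OF norm_sum]) (simp add: norm_mult norm_power)
  also have "\<dots> \<le> (\<Sum>j<n. norm (c j) * norm t ^ (n - 1))"
    using t by (intro sum_mono mult_left_mono power_increasing) auto
  also have "\<dots> = (\<Sum>j<n. norm (c j)) * norm t ^ (n - 1)" by (simp add: sum_distrib_right)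
  finally have "norm (c n) * norm t * norm t ^ (n - 1) \<le> (\<Sum>j<n. norm (c j)) * norm t ^ (n - 1)"
    using n by (cases n) (simp_all add: mult_ac)
  moreover have "norm t ^ (n - 1) > 0" using t by (intro zero_less_power) linarith
  ultimately have "norm (c n) * norm t \<le> (\<Sum>j<n. norm (c j))"
    by (rule mult_right_le_imp_le)
  then show ?thesis using assms(2) by (simp add: field_simps le_max_iff_disj)
qed simp

text \<open>The Cauchy bound for the values of \<open>p\<close> on a fibre is continuous in the base
  point as long as the leading coefficient is nonzero; hence \<open>p\<close> stays bounded on all
  fibres near \<open>y\<close>. Applied to coordinates, this is properness.\<close>

lemma alg_rel_eventually_bounded:
  assumes rel: "alg_rel G p n c" and lead: "c n y \<noteq> 0"
  shows "\<exists>B. eventually (\<lambda>w. \<forall>x. G x = w \<longrightarrow> norm (p x) \<le> B) (nhds y)"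
proof -
  have c: "polyfun (c j)" for j using rel by (simp add: alg_rel_def)
  have lim: "(c j \<longlongrightarrow> c j y) (nhds y)" for j
    using polyfun_continuous[OF c, of UNIV j]
    by (simp add: continuous_on_eq_continuous_at isCont_def tendsto_nhds_iff)
  define s where "s w = (\<Sum>j<n. norm (c j w)) / norm (c n w)" for w
  have "(s \<longlongrightarrow> s y) (nhds y)"
    unfolding s_def by (intro tendsto_intros lim) (use lead in simp)
  then have "eventually (\<lambda>w. s w < s y + 1) (nhds y)"
    by (rule order_tendstoD(2)) simp
  moreover have "eventually (\<lambda>w. c n w \<noteq> 0) (nhds y)"
    using lim lead by (rule tendsto_imp_eventually_ne)
  ultimately have "eventually (\<lambda>w. \<forall>x. G x = w \<longrightarrow> norm (p x) \<le> max 1 (s y + 1)) (nhds y)"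
  proof eventually_elim
    case (elim w)
    show ?case
    proof (intro allI impI)
      fix x assume "G x = w"
      then have "(\<Sum>j\<le>n. c j w * p x ^ j) = 0" using rel by (auto simp: alg_rel_def)
      then have "norm (p x) \<le> max 1 (s w)"
        unfolding s_def using elim(2) by (rule root_bound)
      then show "norm (p x) \<le> max 1 (s y + 1)" using elim(1) by linarith
    qed
  qed
  then show ?thesis by blast
qed

lemma alg_rel_finite_values:
  assumes "alg_rel G p n c" and "c n y \<noteq> 0"
  shows "finite (p ` {x. G x = y})"
proof (rule finite_subset)
  show "p ` {x. G x = y} \<subseteq> {t. (\<Sum>j\<le>n. c j y * t ^ j) = 0}"
    using assms(1) by (auto simp: alg_rel_def)
  show "finite {t. (\<Sum>j\<le>n. c j y * t ^ j) = 0}"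
    by (rule polyfun_rootbound_finite) (use assms(2) in auto)
qed

lemma finite_cart:
  assumes "\<And>i. finite ((\<lambda>x. x $ i) ` S)"
  shows "finite (S :: (complex ^ 'n::finite) set)"
proof (rule finite_imageD)
  show "finite (vec_nth ` S)"
    by (rule finite_subset[OF _ finite_PiE[OF finite, of UNIV "\<lambda>i. (\<lambda>x. x $ i) ` S"]])
      (use assms in auto)
  show "inj_on vec_nth S" by (simp add: inj_on_def vec_nth_inject)
qed

text \<open>The hypersurface \<open>z = 0\<close> contains all bad values: over its complement
  \<open>G\<close> is proper and unramified with finite fibres. Empty fibres are allowed, which
  accommodates maps that are not dominant.\<close>

definition proper_locus ::
    "(complex ^ 'n::finite \<Rightarrow> complex ^ 'n) \<Rightarrow> (complex ^ 'n \<Rightarrow> complex) \<Rightarrow> bool" where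
  "proper_locus G z \<longleftrightarrow> polyfun z \<and> (\<exists>y. z y \<noteq> 0) \<and>
     (\<forall>y. z y \<noteq> 0 \<longrightarrow> finite {x. G x = y} \<and> (\<forall>x. G x = y \<longrightarrow> det (jacobian G x) \<noteq> 0) \<and>
       (\<exists>B. eventually (\<lambda>w. \<forall>x. G x = w \<longrightarrow> norm x \<le> B) (nhds y)))"

lemma proper_locus_exists:
  fixes G :: "complex ^ 'n::finite \<Rightarrow> complex ^ 'n"
  assumes G: "\<And>i. polyfun (\<lambda>x. G x $ i)"
  shows "\<exists>z. proper_locus G z"
proof (cases "\<exists>r. polyfun r \<and> (\<forall>x. r (G x) = 0) \<and> (\<exists>y. r y \<noteq> 0)")
  case True
  then obtain r where r: "polyfun r" "\<And>x. r (G x) = 0" "\<exists>y. r y \<noteq> 0" by blast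
  have "eventually (\<lambda>w. \<forall>x. G x = w \<longrightarrow> norm x \<le> 0) (nhds y)" if "r y \<noteq> 0" for y
  proof -
    have "(r \<longlongrightarrow> r y) (nhds y)"
      using polyfun_continuous[OF r(1), of UNIV]
      by (simp add: continuous_on_eq_continuous_at isCont_def tendsto_nhds_iff)
    then have "eventually (\<lambda>w. r w \<noteq> 0) (nhds y)"
      using that by (rule tendsto_imp_eventually_ne)
    then show ?thesis by eventually_elim (use r(2) in auto)
  qed
  moreover have "{x. G x = y} = {}" if "r y \<noteq> 0" for y using that r(2) by auto
  ultimately have "finite {x. G x = y} \<and> (\<forall>x. G x = y \<longrightarrow> det (jacobian G x) \<noteq> 0) \<and>
      (\<exists>B. eventually (\<lambda>w. \<forall>x. G x = w \<longrightarrow> norm x \<le> B) (nhds y))" if "r y \<noteq> 0" for y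
    using that r(2) by (intro conjI exI[of _ 0]) auto
  \<comment> \<open>The image of \<open>G\<close> lies in \<open>r = 0\<close>, so over the
    complement every fibre is empty and all conditions hold vacuously.\<close>
  then have "proper_locus G r"
    unfolding proper_locus_def by (intro conjI r allI impI) auto
  then show ?thesis by blast
next
  case False
  then have indep: "\<forall>r. polyfun r \<longrightarrow> (\<forall>x. r (G x) = 0) \<longrightarrow> (\<forall>y. r y = 0)" by blast
  have "\<exists>n c. min_rel G (\<lambda>x. x $ i) n c" for i
    by (intro min_rel_exists G polyfun.coord)
  then obtain n c where nc: "\<And>i. min_rel G (\<lambda>x. x $ i) (n i) (c i)" by metis
  then have rel: "\<And>i. alg_rel G (\<lambda>x. x $ i) (n i) (c i)" by (simp add: min_rel_def)
  let ?J = "\<lambda>x. det (jacobian G x)"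
  obtain m b where mb: "min_rel G ?J m b"
    using min_rel_exists[OF G polyfun_det_jacobian[OF G]] by blast
  then have b: "polyfun (b j)" "\<And>x. (\<Sum>j\<le>m. b j (G x) * ?J x ^ j) = 0" for j
    by (auto simp: min_rel_def alg_rel_def)
  obtain a where "?J a \<noteq> 0" using det_jacobian_nonzero[OF G indep] by blast
  then have b0: "\<exists>y. b 0 y \<noteq> 0"
    by (rule min_rel_const_coeff[OF G indep mb polyfun_det_jacobian[OF G]])
  have lead: "polyfun (c i (n i))" "\<exists>y. c i (n i) y \<noteq> 0" for i
    using rel[of i] by (auto simp: alg_rel_def)
  \<comment> \<open>The factors \<open>c i (n i)\<close> keep all coordinates bounded on nearby
    fibres, and \<open>b 0\<close> keeps the Jacobian determinant away from zero.\<close>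
  define z where "z y = b 0 y * (\<Prod>i\<in>UNIV. c i (n i) y)" for y
  have "polyfun z" unfolding z_def by (intro polyfun_intros b lead)
  moreover have "\<exists>y. z y \<noteq> 0"
  proof -
    obtain y where "\<forall>i\<in>UNIV. c i (n i) y \<noteq> 0"
      using polyfun_prod_nonzero[of UNIV "\<lambda>i. c i (n i)"] lead by auto
    then have "(\<Prod>i\<in>UNIV. c i (n i) y) \<noteq> 0" by simp
    moreover have "polyfun (\<lambda>y. \<Prod>i\<in>UNIV. c i (n i) y)" by (intro polyfun_intros lead)
    ultimately obtain w where "b 0 w \<noteq> 0" "(\<Prod>i\<in>UNIV. c i (n i) w) \<noteq> 0"
      using b0 polyfun_mult_nonzero[OF b(1)[of 0]] by blast
    then show ?thesis unfolding z_def by (intro exI[of _ w]) simp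
  qed
  moreover have "finite {x. G x = y}" if "z y \<noteq> 0" for y
    by (rule finite_cart, rule alg_rel_finite_values[OF rel]) (use that in \<open>auto simp: z_def\<close>)
  \<comment> \<open>At a zero of the determinant its relation reduces to the constant coefficient,
    by \<open>0 ^ 0 = 1\<close>.\<close>
  moreover have "?J x \<noteq> 0" if "z y \<noteq> 0" "G x = y" for x y
  proof
    assume "?J x = 0"
    with b(2)[of x] have "b 0 y = 0" using that(2) by (simp add: sum.atMost_shift power_0_left)
    with that(1) show False by (simp add: z_def)
  qed
  moreover have "\<exists>B. eventually (\<lambda>w. \<forall>x. G x = w \<longrightarrow> norm x \<le> B) (nhds y)" if "z y \<noteq> 0" for y
  proof -
    have ex: "\<forall>i. \<exists>B. eventually (\<lambda>w. \<forall>x. G x = w \<longrightarrow> norm (x $ i) \<le> B) (nhds y)"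
      by (rule allI, rule alg_rel_eventually_bounded[OF rel]) (use that in \<open>auto simp: z_def\<close>)
    obtain B where "\<forall>i. eventually (\<lambda>w. \<forall>x. G x = w \<longrightarrow> norm (x $ i) \<le> B i) (nhds y)"
      using choice[OF ex] by blast
    then have "eventually (\<lambda>w. \<forall>i. \<forall>x. G x = w \<longrightarrow> norm (x $ i) \<le> B i) (nhds y)"
      by (intro eventually_all_finite) blast
    then have "eventually (\<lambda>w. \<forall>x. G x = w \<longrightarrow> norm x \<le> (\<Sum>i\<in>UNIV. B i)) (nhds y)"
    proof eventually_elim
      case (elim w)
      show ?case
      proof (intro allI impI)
        fix x assume "G x = w"
        have "norm x \<le> (\<Sum>i\<in>UNIV. norm (x $ i))"
          unfolding norm_vec_def by (rule L2_set_le_sum) simp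
        also have "\<dots> \<le> (\<Sum>i\<in>UNIV. B i)" using elim \<open>G x = w\<close> by (intro sum_mono) auto
        finally show "norm x \<le> (\<Sum>i\<in>UNIV. B i)" .
      qed
    qed
    then show ?thesis by blast
  qed
  ultimately show ?thesis
    unfolding proper_locus_def by (intro exI[of _ z] conjI allI impI)
qed

text \<open>Around each point of the fibre, openness gives at least one preimage of a nearby value
  and local injectivity at most one; properness excludes preimages elsewhere.\<close>

lemma proper_locus_fibre_card_locally_constant:
  fixes G :: "complex ^ 'n::finite \<Rightarrow> complex ^ 'n"
  assumes G: "\<And>i. polyfun (\<lambda>x. G x $ i)" and z: "proper_locus G z" "z y \<noteq> 0"
  shows "eventually (\<lambda>w. card {x. G x = w} = card {x. G x = y}) (nhds y)"
proof -
  let ?F = "\<lambda>w. {x. G x = w}"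
  have fin: "finite (?F y)" and nz: "\<And>x. x \<in> ?F y \<Longrightarrow> det (jacobian G x) \<noteq> 0"
    using z by (auto simp: proper_locus_def)
  obtain B where B: "eventually (\<lambda>w. \<forall>x. G x = w \<longrightarrow> norm x \<le> B) (nhds y)"
    using z by (auto simp: proper_locus_def)
  have "\<exists>r>0. inj_on G (ball x r)" if "x \<in> ?F y" for x
    using jacobian_locally_injective[OF G nz[OF that]] by blast
  then obtain r where r: "\<And>x. x \<in> ?F y \<Longrightarrow> r x > 0" "\<And>x. x \<in> ?F y \<Longrightarrow> inj_on G (ball x (r x))"
    by metis
  \<comment> \<open>Half the mutual distances make the balls of radius \<open>\<rho>\<close>
    disjoint; the 1 keeps \<open>D\<close> nonempty when the fibre is empty.\<close>
  define D where "D = insert 1 (r ` ?F y \<union>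
    (\<lambda>(x, x'). dist x x' / 2) ` {(x, x'). x \<in> ?F y \<and> x' \<in> ?F y \<and> x \<noteq> x'})"
  have finD: "finite D"
  proof -
    have "finite {(x, x'). x \<in> ?F y \<and> x' \<in> ?F y \<and> x \<noteq> x'}"
      by (rule finite_subset[of _ "?F y \<times> ?F y"]) (use fin in auto)
    then show ?thesis using fin by (simp add: D_def)
  qed
  define \<rho> where "\<rho> = Min D"
  have "\<rho> > 0" unfolding \<rho>_def using finD r by (subst Min_gr_iff) (auto simp: D_def)
  have le: "\<rho> \<le> d" if "d \<in> D" for d unfolding \<rho>_def using finD that by (rule Min_le)
  have \<rho>: "\<rho> \<le> r x" if "x \<in> ?F y" for x
    by (rule le) (use that in \<open>simp add: D_def\<close>)
  have sep: "\<rho> \<le> dist x x' / 2" if "x \<in> ?F y" "x' \<in> ?F y" "x \<noteq> x'" for x x'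
    by (rule le, unfold D_def, intro insertI2 UnI2 image_eqI[of _ _ "(x, x')"]) (use that in auto)
  define U where "U = (\<Union>x\<in>?F y. ball x \<rho>)"
  \<comment> \<open>\<open>B\<close> bounds the fibres near \<open>y\<close>. A point of such a
    fibre outside \<open>U\<close> would lie in this compact set, whose image is closed and misses
    \<open>y\<close>.\<close>
  have "compact (cball 0 B - U)"
    unfolding U_def by (intro compact_diff compact_cball) auto
  then have "closed (G ` (cball 0 B - U))"
    by (intro compact_imp_closed compact_continuous_image continuous_on_polynomial_map[OF G])
  moreover have "y \<notin> G ` (cball 0 B - U)" using \<open>\<rho> > 0\<close> by (auto simp: U_def)
  ultimately have "eventually (\<lambda>w. w \<in> - G ` (cball 0 B - U)) (nhds y)"
    by (intro eventually_nhds_in_open) auto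
  moreover have "eventually (\<lambda>w. \<forall>x\<in>?F y. w \<in> G ` ball x \<rho>) (nhds y)"
  proof (rule eventually_ball_finite[OF fin], rule ballI)
    fix x assume x: "x \<in> ?F y"
    then have "y \<in> interior (G ` ball x \<rho>)"
      using jacobian_open_at[OF G nz \<open>\<rho> > 0\<close>] by auto
    then show "eventually (\<lambda>w. w \<in> G ` ball x \<rho>) (nhds y)"
      using interior_subset by (intro eventually_mono[OF eventually_nhds_in_open[OF open_interior]]) auto
  qed
  ultimately show ?thesis using B
  proof eventually_elim
    case (elim w)
    have inU: "x \<in> U" if "x \<in> ?F w" for x
      using elim(1,3) that by auto
    have single: "card (?F w \<inter> ball x \<rho>) = 1" if x: "x \<in> ?F y" for x
    proof -
      obtain v where v: "v \<in> ball x \<rho>" "G v = w" using elim(2) x by auto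
      have inj: "inj_on G (ball x \<rho>)"
        using r(2)[OF x] by (rule inj_on_subset) (use \<rho>[OF x] in auto)
      have "?F w \<inter> ball x \<rho> = {v}" using v inj_onD[OF inj] by auto
      then show ?thesis by simp
    qed
    have "?F w = (\<Union>x\<in>?F y. ?F w \<inter> ball x \<rho>)"
      using inU unfolding U_def by blast
    also have "card \<dots> = (\<Sum>x\<in>?F y. card (?F w \<inter> ball x \<rho>))"
    proof (rule card_UN_disjoint[OF fin])
      show "\<forall>x\<in>?F y. finite (?F w \<inter> ball x \<rho>)"
      proof
        fix x assume "x \<in> ?F y"
        from single[OF this] show "finite (?F w \<inter> ball x \<rho>)"
          by (intro card_ge_0_finite) linarith
      qed
      show "\<forall>x\<in>?F y. \<forall>x'\<in>?F y. x \<noteq> x' \<longrightarrow>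
          (?F w \<inter> ball x \<rho>) \<inter> (?F w \<inter> ball x' \<rho>) = {}"
      proof (intro ballI impI)
        fix x x' assume "x \<in> ?F y" "x' \<in> ?F y" "x \<noteq> x'"
        then have "\<rho> + \<rho> \<le> dist x x'" using sep[of x x'] by simp
        then have "ball x \<rho> \<inter> ball x' \<rho> = {}" by (simp add: disjoint_ballI)
        then show "(?F w \<inter> ball x \<rho>) \<inter> (?F w \<inter> ball x' \<rho>) = {}" by blast
      qed
    qed
    also have "\<dots> = card (?F y)" using single by simp
    finally show ?case .
  qed
qed

text \<open>The complex line through \<open>a\<close> and \<open>b\<close> meets
  \<open>z = 0\<close> for finitely many parameters only, and the complex plane without finitely
  many points is connected.\<close>

lemma proper_locus_fibre_card_constant:
  fixes G :: "complex ^ 'n::finite \<Rightarrow> complex ^ 'n"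
  assumes G: "\<And>i. polyfun (\<lambda>x. G x $ i)" and z: "proper_locus G z"
    and a: "z a \<noteq> 0" and b: "z b \<noteq> 0"
  shows "card {x. G x = a} = card {x. G x = b}"
proof -
  let ?l = "\<lambda>t. a + t *s (b - a)"
  define T where "T = UNIV - {t. z (?l t) = 0}"
  have "polyfun z" using z by (simp add: proper_locus_def)
  then have fin: "finite {t. z (?l t) = 0}"
    by (rule polyfun_zeros_on_line_finite[where ?t0.0 = 0]) (use a in simp)
  have "connected T"
    unfolding T_def by (rule connected_open_delete_finite) (use fin in auto)
  moreover have "0 \<in> T" "1 \<in> T" using a b by (auto simp: T_def)
  moreover have "eventually (\<lambda>u. card {x. G x = ?l t} = card {x. G x = ?l u}) (at t within T)"
    if "t \<in> T" for t
  proof -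
    have "filterlim ?l (nhds (?l t)) (at t within T)"
      using continuous_vector_line that unfolding continuous_on_def by blast
    moreover have "eventually (\<lambda>w. card {x. G x = w} = card {x. G x = ?l t}) (nhds (?l t))"
      by (rule proper_locus_fibre_card_locally_constant[OF G z]) (use that in \<open>auto simp: T_def\<close>)
    ultimately have "eventually (\<lambda>u. card {x. G x = ?l u} = card {x. G x = ?l t}) (at t within T)"
      unfolding filterlim_iff by blast
    then show ?thesis by eventually_elim simp
  qed
  ultimately have "card {x. G x = ?l 0} = card {x. G x = ?l 1}"
    by (intro connected_local_const[of T 0 1 "\<lambda>t. card {x. G x = ?l t}"]) blast+
  then show ?thesis by simp
qed

section \<open>General points of projective space\<close>

abbreviation line :: "complex ^ 'n::finite \<Rightarrow> (complex ^ 'n) set" where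
  "line x \<equiv> vec.span {x}"

lemma cpoly_eval_superset:
  assumes "finite M" and "Poly_Mapping.keys f \<subseteq> M"
  shows "cpoly_eval f x =
    (\<Sum>m\<in>M. Poly_Mapping.lookup f m * monom_fun (Poly_Mapping.lookup m) x)"
  unfolding cpoly_eval_def monom_fun_def
  using assms by (intro sum.mono_neutral_left) (auto simp: in_keys_iff)

lemma cpoly_eval_keys:
  "cpoly_eval f x =
    (\<Sum>m\<in>Poly_Mapping.keys f. Poly_Mapping.lookup f m * monom_fun (Poly_Mapping.lookup m) x)"
  by (rule cpoly_eval_superset) auto

lemma polyfun_cpoly_eval: "polyfun (cpoly_eval f)"
  unfolding cpoly_eval_def by (intro polyfun_intros)

lemma cpoly_eval_scale:
  assumes "homogeneous d f"
  shows "cpoly_eval f (t *s x) = t ^ d * cpoly_eval f x"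
  using assms
  by (auto simp: cpoly_eval_keys homogeneous_def monom_fun_scale sum_distrib_left mult_ac
      intro!: sum.cong)

lemma inj_lookup_poly_mapping: "inj Poly_Mapping.lookup"
  by (simp add: inj_def poly_mapping_eqI)

lemma bij_betw_lookup:
  "bij_betw Poly_Mapping.lookup {m :: 'n::finite \<Rightarrow>\<^sub>0 nat. Poly_Mapping.lookup m \<in> M} M"
proof -
  have "\<alpha> \<in> range Poly_Mapping.lookup" for \<alpha> :: "'n \<Rightarrow> nat"
    by (metis finite lookup_Abs_poly_mapping rangeI)
  then have "Poly_Mapping.lookup ` {m :: 'n \<Rightarrow>\<^sub>0 nat. Poly_Mapping.lookup m \<in> M} = M"
    by (force simp: image_def)
  then show ?thesis
    using inj_lookup_poly_mapping by (simp add: bij_betw_def inj_on_def)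
qed

lemma cpoly_of_coefficients:
  fixes a :: "('n::finite \<Rightarrow> nat) \<Rightarrow> complex"
  assumes "finite M"
  obtains g :: "'n cpoly" where "\<And>x. cpoly_eval g x = (\<Sum>\<alpha>\<in>M. a \<alpha> * monom_fun \<alpha> x)"
    and "\<And>m. m \<in> Poly_Mapping.keys g \<Longrightarrow> Poly_Mapping.lookup m \<in> M"
proof -
  let ?M = "{m :: 'n \<Rightarrow>\<^sub>0 nat. Poly_Mapping.lookup m \<in> M}"
  define c where
    "c m = (if Poly_Mapping.lookup m \<in> M then a (Poly_Mapping.lookup m) else 0)" for m
  define g where "g = Poly_Mapping.Abs_poly_mapping c"
  have fin: "finite ?M" using bij_betw_lookup assms by (metis bij_betw_finite)
  then have "finite {m. c m \<noteq> 0}" by (rule rev_finite_subset) (auto simp: c_def)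
  then have lookup: "Poly_Mapping.lookup g = c" unfolding g_def by (rule lookup_Abs_poly_mapping)
  have keys: "Poly_Mapping.lookup m \<in> M" if "m \<in> Poly_Mapping.keys g" for m
    using that by (simp add: in_keys_iff lookup c_def split: if_splits)
  have "cpoly_eval g x = (\<Sum>\<alpha>\<in>M. a \<alpha> * monom_fun \<alpha> x)" for x
  proof -
    have "cpoly_eval g x =
        (\<Sum>m\<in>?M. a (Poly_Mapping.lookup m) * monom_fun (Poly_Mapping.lookup m) x)"
      using fin keys by (subst cpoly_eval_superset[of ?M]) (auto simp: lookup c_def)
    also have "\<dots> = (\<Sum>\<alpha>\<in>M. a \<alpha> * monom_fun \<alpha> x)"
      by (rule sum.reindex_bij_betw[OF bij_betw_lookup])
    finally show ?thesis .
  qed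
  with keys show ?thesis by (rule that[rotated])
qed

text \<open>Zariski open sets of projective space need homogeneous equations, whereas
  \<open>z\<close> is arbitrary. If a homogeneous component \<open>g\<close> is nonzero at
  \<open>x\<close>, then \<open>z\<close> restricted to the line of \<open>x\<close> is a nonzero
  polynomial in the parameter.\<close>

lemma homogeneous_component_nonzero:
  fixes z :: "complex ^ 'n::finite \<Rightarrow> complex"
  assumes "polyfun z" and "z y \<noteq> 0"
  obtains e g x where "homogeneous e g" and "cpoly_eval g x \<noteq> 0"
    and "\<And>x. cpoly_eval g x \<noteq> 0 \<Longrightarrow> \<exists>t. t \<noteq> 0 \<and> z (t *s x) \<noteq> 0"
proof -
  obtain k a where a: "\<And>x. z x = (\<Sum>\<alpha>\<in>exponent_box k. a \<alpha> * monom_fun \<alpha> x)"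
    using polyfun_box_span[OF assms(1)] box_span_explicit by metis
  define wt where "wt \<alpha> = (\<Sum>i\<in>UNIV. \<alpha> i)" for \<alpha> :: "'n \<Rightarrow> nat"
  define J where "J = Max (wt ` exponent_box k)"
  define h where "h j x = (\<Sum>\<alpha>\<in>{\<alpha> \<in> exponent_box k. wt \<alpha> = j}. a \<alpha> * monom_fun \<alpha> x)" for j x
  have z: "z (t *s x) = (\<Sum>j\<le>J. h j x * t ^ j)" for t x
  proof -
    have "z (t *s x) = (\<Sum>\<alpha>\<in>exponent_box k. a \<alpha> * monom_fun \<alpha> x * t ^ wt \<alpha>)"
      by (simp add: a monom_fun_scale wt_def mult_ac)
    also have "\<dots> = (\<Sum>j\<le>J. \<Sum>\<alpha>\<in>{\<alpha> \<in> exponent_box k. wt \<alpha> = j}. a \<alpha> * monom_fun \<alpha> x * t ^ wt \<alpha>)"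
      by (rule sum.group[symmetric]) (auto simp: J_def)
    also have "\<dots> = (\<Sum>j\<le>J. h j x * t ^ j)"
      by (simp add: h_def sum_distrib_right)
    finally show ?thesis .
  qed
  have "\<exists>j\<le>J. h j y \<noteq> 0"
  proof (rule ccontr)
    assume "\<not> ?thesis"
    then have "z y = 0" using z[of 1 y] by simp
    with assms(2) show False by simp
  qed
  then obtain j where j: "j \<le> J" "h j y \<noteq> 0" by blast
  obtain g :: "'n cpoly" where g: "\<And>x. cpoly_eval g x = h j x"
    "\<And>m. m \<in> Poly_Mapping.keys g \<Longrightarrow> Poly_Mapping.lookup m \<in> {\<alpha> \<in> exponent_box k. wt \<alpha> = j}"
    unfolding h_def by (rule cpoly_of_coefficients[of "{\<alpha> \<in> exponent_box k. wt \<alpha> = j}" a]) auto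
  have "homogeneous j g" using g(2) by (auto simp: homogeneous_def wt_def)
  moreover have "\<exists>t. t \<noteq> 0 \<and> z (t *s x) \<noteq> 0" if "cpoly_eval g x \<noteq> 0" for x
  proof -
    have "finite {t. (\<Sum>j\<le>J. h j x * t ^ j) = 0}"
      by (rule polyfun_rootbound_finite) (use that g(1) j(1) in auto)
    \<comment> \<open>The parameter 0 is excluded too, so that the multiple found spans the same
      line.\<close>
    then have "finite (insert 0 {t. z (t *s x) = 0})" by (simp add: z)
    then obtain t where "t \<notin> insert 0 {t. z (t *s x) = 0}"
      using ex_new_if_finite[OF infinite_UNIV_char_0] by blast
    then show ?thesis by blast
  qed
  ultimately show ?thesis using that[of j g y] j g(1) by simp
qed

lemma line_eq_range: "line x = range (\<lambda>t. t *s x)"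
  by (rule vec.span_singleton)

lemma line_scale: "t \<noteq> 0 \<Longrightarrow> line (t *s x) = line x"
proof (rule antisym)
  assume "t \<noteq> 0"
  then have "x = inverse t *s (t *s x)" by (simp add: vector_smult_assoc)
  then have "x \<in> line (t *s x)" unfolding line_eq_range by (rule range_eqI)
  then show "line x \<subseteq> line (t *s x)" by (simp add: vec.span_minimal)
  show "line (t *s x) \<subseteq> line x" by (simp add: vec.span_minimal vec.span_scale vec.span_base)
qed

text \<open>The factor \<open>x $ i\<close> keeps the vector found away from the origin, which
  represents no projective point.\<close>

lemma general_vector:
  assumes "polyfun z" and "z a \<noteq> 0" and "open W" and "b \<in> W"
  obtains y :: "complex ^ 'n::finite" where "y \<in> W" and "y \<noteq> 0" and "z y \<noteq> 0"
proof -
  fix i :: 'n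
  have "(\<lambda>x. x $ i) (axis i (1 :: complex)) \<noteq> 0" by (simp add: axis_def)
  then obtain c where c: "z c \<noteq> 0" "c $ i \<noteq> 0"
    using polyfun_mult_nonzero[OF assms(1,2) polyfun.coord] by blast
  obtain y where "y \<in> W" "z y * y $ i \<noteq> 0"
    by (rule polyfun_nonzero_open[of "\<lambda>x. z x * x $ i" c, OF _ _ assms(3,4)])
      (use c in \<open>auto intro: polyfun.intros assms(1)\<close>)
  moreover from this have "y \<noteq> 0" by auto
  ultimately show ?thesis using that[of y] by simp
qed

text \<open>Generality in terms of an affine equation, the form in which \<open>proper_locus\<close>
  supplies it. One equation out of \<open>S\<close> gives one direction; for the other,
  \<open>P\<close> depends only on the line, so a single representative outside \<open>z = 0\<close>
  suffices.\<close>

lemma for_general_point_iff: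
  "for_general_point P \<longleftrightarrow>
     (\<exists>z. polyfun z \<and> (\<exists>y. z y \<noteq> 0) \<and>
        (\<forall>y :: complex ^ 'n::finite. y \<noteq> 0 \<longrightarrow> z y \<noteq> 0 \<longrightarrow> P (line y)))"
proof
  assume "for_general_point P"
  then obtain S p where S: "\<forall>q \<in> proj_space - {p \<in> proj_space. \<forall>g\<in>S. \<forall>x\<in>p. cpoly_eval g x = 0}. P q"
    "p \<in> proj_space - {p \<in> proj_space. \<forall>g\<in>S. \<forall>x\<in>p. cpoly_eval g x = 0}"
    unfolding for_general_point_def zariski_open_def by blast
  then obtain g x where g: "g \<in> S" "cpoly_eval g x \<noteq> 0" by blast
  have "P (line y)" if "y \<noteq> 0" "cpoly_eval g y \<noteq> 0" for y
  proof -
    have "line y \<in> proj_space" using that by (auto simp: proj_space_def)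
    moreover have "y \<in> line y" by (simp add: vec.span_base)
    ultimately show ?thesis using S(1) that(2) g(1) by blast
  qed
  then show "\<exists>z. polyfun z \<and> (\<exists>y. z y \<noteq> 0) \<and> (\<forall>y. y \<noteq> 0 \<longrightarrow> z y \<noteq> 0 \<longrightarrow> P (line y))"
    using g(2) polyfun_cpoly_eval[of g] by blast
next
  assume "\<exists>z. polyfun z \<and> (\<exists>y. z y \<noteq> 0) \<and>
        (\<forall>y :: complex ^ 'n::finite. y \<noteq> 0 \<longrightarrow> z y \<noteq> 0 \<longrightarrow> P (line y))"
  then obtain z y where z: "polyfun z" "z y \<noteq> 0"
    "\<And>y. y \<noteq> 0 \<Longrightarrow> z y \<noteq> 0 \<Longrightarrow> P (line y)" by blast
  obtain e g x where g: "homogeneous e g" "cpoly_eval g x \<noteq> 0"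
    "\<And>x. cpoly_eval g x \<noteq> 0 \<Longrightarrow> \<exists>t. t \<noteq> 0 \<and> z (t *s x) \<noteq> 0"
    using homogeneous_component_nonzero[OF z(1,2)] by metis
  let ?U = "proj_space - {p \<in> proj_space. \<forall>g\<in>{g}. \<forall>x\<in>p. cpoly_eval g x = 0}"
  have "zariski_open ?U" unfolding zariski_open_def using g(1) by blast
  moreover obtain w where "w \<noteq> 0" "cpoly_eval g w \<noteq> 0"
    using general_vector[OF polyfun_cpoly_eval g(2) open_UNIV UNIV_I] by blast
  then have "line w \<in> ?U" by (auto simp: proj_space_def intro: vec.span_base)
  then have "?U \<noteq> {}" by blast
  moreover have "P p" if p: "p \<in> ?U" for p
  proof -
    obtain v where v: "v \<noteq> 0" "p = line v" using p by (auto simp: proj_space_def)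
    obtain t where "cpoly_eval g (t *s v) \<noteq> 0" using p unfolding v(2) line_eq_range by auto
    then have "cpoly_eval g v \<noteq> 0" by (auto simp: cpoly_eval_scale[OF g(1)])
    then obtain t where "t \<noteq> 0" "z (t *s v) \<noteq> 0" using g(3) by blast
    then show "P p" using z(3)[of "t *s v"] v line_scale[of t v] by (auto simp: vec.scale_eq_0_iff)
  qed
  ultimately show "for_general_point P" unfolding for_general_point_def by blast
qed

lemma for_general_point_in_open:
  assumes "for_general_point P" and "open W" and "b \<in> W"
  obtains y :: "complex ^ 'n::finite" where "y \<in> W" and "y \<noteq> 0" and "P (line y)"
  using assms general_vector unfolding for_general_point_iff by metis

lemma for_general_point_conj:
  assumes "for_general_point P" and "for_general_point Q"
  shows "for_general_point (\<lambda>p :: (complex ^ 'n::finite) set. P p \<and> Q p)"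
proof -
  obtain u a where u: "polyfun u" "u a \<noteq> 0" "\<And>y. y \<noteq> 0 \<Longrightarrow> u y \<noteq> 0 \<Longrightarrow> P (line y)"
    using assms(1) unfolding for_general_point_iff by blast
  obtain v b where v: "polyfun v" "v b \<noteq> 0" "\<And>y. y \<noteq> 0 \<Longrightarrow> v y \<noteq> 0 \<Longrightarrow> Q (line y)"
    using assms(2) unfolding for_general_point_iff by blast
  obtain c where "u c \<noteq> 0" "v c \<noteq> 0" using polyfun_mult_nonzero[OF u(1,2) v(1,2)] .
  then have "u c * v c \<noteq> 0" by simp
  then show ?thesis
    unfolding for_general_point_iff using u v
    by (intro exI[of _ "\<lambda>x. u x * v x"]) (auto intro: polyfun.intros)
qed

text \<open>Two generic cardinalities are attained at a common point, so the definite description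
  has no second candidate.\<close>

lemma polar_degree_eqI:
  assumes "for_general_point (\<lambda>q. finite (grad_fibre f q) \<and> card (grad_fibre f q) = k)"
  shows "polar_degree f = k"
  unfolding polar_degree_def
proof (rule the_equality)
  show "for_general_point (\<lambda>q. finite (grad_fibre f q) \<and> card (grad_fibre f q) = k)" by (rule assms)
  fix l assume "for_general_point (\<lambda>q. finite (grad_fibre f q) \<and> card (grad_fibre f q) = l)"
  from for_general_point_in_open[OF for_general_point_conj[OF assms this] open_UNIV UNIV_I]
  show "l = k" by auto
qed

lemma gradient_nth: "gradient f x $ i = partial i (cpoly_eval f) x"
  by (simp add: gradient_def partial_def)

lemma polyfun_gradient: "polyfun (\<lambda>x. gradient f x $ i)"
  unfolding gradient_nth by (rule polyfun_partial[OF polyfun_cpoly_eval])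

text \<open>Differentiating \<open>f (t *s x) = t ^ Suc e * f x\<close> in \<open>x\<close> gives
  the claim multiplied by \<open>t\<close>.\<close>

lemma gradient_scale:
  assumes "homogeneous (Suc e) f"
  shows "gradient f (t *s x) = t ^ e *s gradient f x"
proof -
  have nonzero: "gradient f (t *s x) $ i = t ^ e * gradient f x $ i" if "t \<noteq> 0" for t i
  proof -
    let ?F = "cpoly_eval f"
    have lin: "bounded_linear (\<lambda>x :: complex ^ 'n. t *s x)"
      by (simp add: linear_conv_bounded_linear[symmetric] linear_iff vec_eq_iff algebra_simps)
    have "((\<lambda>x. ?F (t *s x)) has_derivative (\<lambda>h. \<Sum>j\<in>UNIV. partial j ?F (t *s x) * (t *s h) $ j)) (at x)"
      by (rule has_derivative_compose[OF bounded_linear_imp_has_derivative[OF lin]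
            polyfun_has_derivative[OF polyfun_cpoly_eval]])
    then have "((\<lambda>x. ?F (t *s x)) has_derivative (\<lambda>h. \<Sum>j\<in>UNIV. (t * partial j ?F (t *s x)) * h $ j)) (at x)"
      by (simp add: mult_ac)
    then have "partial i (\<lambda>x. ?F (t *s x)) x = t * partial i ?F (t *s x)"
      by (rule partial_eqI)
    moreover have "((\<lambda>x. t ^ Suc e * ?F x) has_derivative
        (\<lambda>h. t ^ Suc e * (\<Sum>j\<in>UNIV. partial j ?F x * h $ j))) (at x)"
      by (rule has_derivative_mult_right[OF polyfun_has_derivative[OF polyfun_cpoly_eval]])
    then have "((\<lambda>x. t ^ Suc e * ?F x) has_derivative
        (\<lambda>h. \<Sum>j\<in>UNIV. (t ^ Suc e * partial j ?F x) * h $ j)) (at x)"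
      by (simp add: sum_distrib_left mult_ac)
    then have "partial i (\<lambda>x. t ^ Suc e * ?F x) x = t ^ Suc e * partial i ?F x"
      by (rule partial_eqI)
    ultimately have "t * partial i ?F (t *s x) = t ^ Suc e * partial i ?F x"
      by (simp only: cpoly_eval_scale[OF assms])
    with that show ?thesis by (simp add: gradient_nth)
  qed
  \<comment> \<open>For \<open>t = 0\<close> the factor cannot be cancelled; there the identity
    holds because both sides are polynomials in \<open>t\<close> that agree at all other
    points.\<close>
  have "gradient f (t *s x) $ i = t ^ e * gradient f x $ i" for i
  proof -
    obtain u where "\<And>t. gradient f (0 + t *s x) $ i = poly u t"
      using polyfun_line[OF polyfun_gradient[of f i], of 0 x] by blast
    then have u: "poly u t = gradient f (t *s x) $ i" for t by (metis add_0)
    let ?v = "u - monom (gradient f x $ i) e"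
    have "UNIV - {0} \<subseteq> {t. poly ?v t = 0}"
      using nonzero by (auto simp: u poly_monom mult_ac)
    then have "infinite {t. poly ?v t = 0}"
      by (metis Diff_infinite_finite finite.emptyI finite.insertI finite_subset infinite_UNIV_char_0)
    then have "?v = 0" using poly_roots_finite by blast
    then have "poly ?v t = 0" by simp
    then show ?thesis by (simp add: u poly_monom mult_ac)
  qed
  then show ?thesis by (simp add: vec_eq_iff)
qed

section \<open>The polar degree as a fibre cardinality\<close>

context
  fixes f :: "'n::finite cpoly" and e :: nat
  assumes hom: "homogeneous (Suc e) f" and e: "e > 0"
begin

lemma gradient_0: "gradient f 0 = 0"
  using gradient_scale[OF hom, of 0 0] e by (simp add: power_0_left)

lemma grad_map_line: "grad_map f (line x) = line (gradient f x)"
proof (rule antisym)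
  show "grad_map f (line x) \<subseteq> line (gradient f x)"
    unfolding grad_map_def
  proof (rule vec.span_minimal)
    show "gradient f ` line x \<subseteq> line (gradient f x)"
      by (auto simp: line_eq_range gradient_scale[OF hom])
  qed (rule vec.subspace_span)
  show "line (gradient f x) \<subseteq> grad_map f (line x)"
    unfolding grad_map_def by (rule vec.span_mono) (simp add: vec.span_base)
qed

text \<open>If the gradient at \<open>v\<close> is only proportional to \<open>y\<close>, rescaling
  \<open>v\<close> by an \<open>e\<close>-th root of the factor makes it equal to \<open>y\<close>.
  This needs \<open>e > 0\<close>.\<close>

lemma grad_fibre_line:
  assumes y: "y \<noteq> 0"
  shows "grad_fibre f (line y) = line ` {x. gradient f x = y}"
proof (intro equalityI subsetI)
  fix p assume "p \<in> grad_fibre f (line y)"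
  then have p: "p \<in> proj_space" "p \<notin> Sing f" "grad_map f p = line y"
    by (auto simp: grad_fibre_def)
  then obtain v where v: "v \<noteq> 0" "p = line v" by (auto simp: proj_space_def)
  then have "y \<in> line (gradient f v)" using p(3) by (metis grad_map_line vec.span_base singletonI)
  then obtain c where c: "y = c *s gradient f v" by (auto simp: line_eq_range)
  then have "c \<noteq> 0" using y by auto
  obtain t where t: "t ^ e = c" using exists_complex_root[of e c] e by auto
  then have "t \<noteq> 0" using \<open>c \<noteq> 0\<close> e by auto
  have "gradient f (t *s v) = y" using t c gradient_scale[OF hom] by simp
  moreover have "p = line (t *s v)" using v \<open>t \<noteq> 0\<close> line_scale by auto
  ultimately show "p \<in> line ` {x. gradient f x = y}" by blast
next
  fix p assume "p \<in> line ` {x. gradient f x = y}"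
  then obtain x where x: "gradient f x = y" "p = line x" by blast
  then have "x \<noteq> 0" using y gradient_0 by auto
  moreover have "x \<in> line x" by (simp add: vec.span_base)
  ultimately show "p \<in> grad_fibre f (line y)"
    using x y by (auto simp: grad_fibre_def proj_space_def Sing_def grad_map_line)
qed

text \<open>The solutions on one line are the multiples of \<open>x\<close> by the
  \<open>e\<close>-th roots of unity.\<close>

lemma card_fibre_on_line:
  assumes x: "gradient f x = y" "y \<noteq> 0"
  shows "card {x' \<in> {x. gradient f x = y}. line x' = line x} = e"
proof -
  have "x \<noteq> 0" using x gradient_0 by auto
  have "{x' \<in> {x. gradient f x = y}. line x' = line x} = (\<lambda>t. t *s x) ` {t. t ^ e = 1}"
  proof (intro equalityI subsetI)
    fix x' assume x': "x' \<in> {x' \<in> {x. gradient f x = y}. line x' = line x}"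
    then have "x' \<in> line x" using vec.span_base[of x' "{x'}"] by simp
    then obtain t where t: "x' = t *s x" by (auto simp: line_eq_range)
    then have "t ^ e *s y = y" using x' x gradient_scale[OF hom, of t x] by simp
    moreover obtain j where "y $ j \<noteq> 0" using x(2) by (auto simp: vec_eq_iff)
    ultimately have "t ^ e = 1"
      by (metis mult_cancel_right1 vector_smult_component)
    then show "x' \<in> (\<lambda>t. t *s x) ` {t. t ^ e = 1}" using t by blast
  next
    fix x' assume "x' \<in> (\<lambda>t. t *s x) ` {t. t ^ e = 1}"
    then obtain t where t: "t ^ e = 1" "x' = t *s x" by blast
    then have "t \<noteq> 0" using e by (auto simp: power_0_left)
    then show "x' \<in> {x' \<in> {x. gradient f x = y}. line x' = line x}"
      using t x gradient_scale[OF hom, of t x] line_scale by simp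
  qed
  moreover have "inj_on (\<lambda>t. t *s x) {t. t ^ e = 1}"
    using \<open>x \<noteq> 0\<close> by (auto simp: inj_on_def vec_eq_iff)
  ultimately show ?thesis using card_roots_unity_eq[OF e] by (simp add: card_image)
qed

lemma card_fibre_eq:
  assumes "finite {x. gradient f x = y}" and "y \<noteq> 0"
  shows "card {x. gradient f x = y} = e * card (grad_fibre f (line y))"
proof -
  let ?F = "{x. gradient f x = y}"
  have "card ?F = (\<Sum>p\<in>line ` ?F. card {x \<in> ?F. line x = p})"
    using sum.image_gen[OF assms(1), of "\<lambda>_. 1 :: nat" line] by simp
  also have "\<dots> = (\<Sum>p\<in>line ` ?F. e)"
    by (intro sum.cong) (use card_fibre_on_line assms(2) in auto)
  finally show ?thesis by (simp add: grad_fibre_line[OF assms(2)])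
qed

text \<open>Constancy of the affine count passes to the projective count after division by
  \<open>e\<close>. Any nonzero \<open>y\<close> off the hypersurface computes the polar degree, so
  a fibre of nondegenerate points can be used.\<close>

lemma polar_degree_proper_locus:
  assumes z: "proper_locus (gradient f) z" and y: "z y \<noteq> 0" "y \<noteq> 0"
  shows "polar_degree f = card (grad_fibre f (line y))" (is "_ = ?k")
    and "for_general_point (\<lambda>q. finite (grad_fibre f q) \<and> card (grad_fibre f q) = polar_degree f)"
proof -
  have "finite (grad_fibre f (line w)) \<and> card (grad_fibre f (line w)) = ?k"
    if w: "w \<noteq> 0" "z w \<noteq> 0" for w
  proof -
    have fin: "finite {x. gradient f x = w}" "finite {x. gradient f x = y}"
      using z w(2) y(1) by (auto simp: proper_locus_def)
    have "e * card (grad_fibre f (line w)) = e * ?k"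
      using proper_locus_fibre_card_constant[OF polyfun_gradient z w(2) y(1)]
        card_fibre_eq[OF fin(1) w(1)] card_fibre_eq[OF fin(2) y(2)] by simp
    then show ?thesis using e fin(1) by (simp add: grad_fibre_line w(1))
  qed
  moreover have "polyfun z" using z by (simp add: proper_locus_def)
  ultimately have gen: "for_general_point (\<lambda>q. finite (grad_fibre f q) \<and> card (grad_fibre f q) = ?k)"
    unfolding for_general_point_iff using y(1) by blast
  then show "polar_degree f = ?k" by (rule polar_degree_eqI)
  then show "for_general_point (\<lambda>q. finite (grad_fibre f q) \<and> card (grad_fibre f q) = polar_degree f)"
    using gen by simp
qed

lemma proper_locus_point:
  obtains z y where "proper_locus (gradient f) z" and "z y \<noteq> 0" and "y \<noteq> 0"
proof -
  obtain z where z: "proper_locus (gradient f) z"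
    using proper_locus_exists[of "gradient f", OF polyfun_gradient] by blast
  then obtain a where "polyfun z" "z a \<noteq> 0" by (auto simp: proper_locus_def)
  then obtain y where "y \<noteq> 0" "z y \<noteq> 0"
    using general_vector[OF _ _ open_UNIV UNIV_I] by blast
  then show ?thesis using that z by blast
qed

lemma general_fibre_card:
  "for_general_point (\<lambda>q. finite (grad_fibre f q) \<and> card (grad_fibre f q) = polar_degree f)"
  using proper_locus_point polar_degree_proper_locus(2) by blast

end

section \<open>Separation of distinct lines under small perturbations\<close>

lemma line_eq_minors:
  assumes "line x = line x'"
  shows "x $ i * x' $ j = x $ j * x' $ i"
proof -
  have "x' \<in> line x" using assms vec.span_base[of x' "{x'}"] by simp
  then show ?thesis by (auto simp: line_eq_range)
qed

lemma line_neq_minor: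
  assumes "x \<noteq> 0" and "x' \<noteq> 0" and "line x \<noteq> line x'"
  obtains i j where "x $ i * x' $ j \<noteq> x $ j * x' $ i"
proof -
  obtain i where i: "x $ i \<noteq> 0" using assms(1) by (auto simp: vec_eq_iff)
  have "\<exists>j. x $ i * x' $ j \<noteq> x $ j * x' $ i"
  proof (rule ccontr)
    assume "\<not> ?thesis"
    then have "x' = (x' $ i / x $ i) *s x" using i by (simp add: vec_eq_iff field_simps)
    moreover from this have "x' $ i / x $ i \<noteq> 0" using assms(2) by auto
    ultimately show False using assms(3) line_scale by metis
  qed
  then show ?thesis using that by blast
qed

text \<open>Distinct lines have a nonzero 2 by 2 minor, which is an open condition on the pair of
  vectors.\<close>

lemma lines_locally_distinct:
  fixes x x' :: "complex ^ 'n::finite"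
  assumes "x \<noteq> 0" and "x' \<noteq> 0" and "line x \<noteq> line x'"
  shows "\<exists>r>0. \<forall>v\<in>ball x r. \<forall>v'\<in>ball x' r. line v \<noteq> line v'"
proof -
  obtain i j where ij: "x $ i * x' $ j \<noteq> x $ j * x' $ i"
    using line_neq_minor[OF assms] .
  define S where "S = {(v :: complex ^ 'n, v' :: complex ^ 'n). v $ i * v' $ j \<noteq> v $ j * v' $ i}"
  have "open S"
    unfolding S_def case_prod_unfold
    by (intro open_Collect_neq continuous_intros)
  moreover have "(x, x') \<in> S" using ij by (simp add: S_def)
  ultimately obtain A B where AB: "open A" "open B" "x \<in> A" "x' \<in> B" "A \<times> B \<subseteq> S"
    by (rule open_prod_elim) auto
  obtain a where a: "a > 0" "ball x a \<subseteq> A" using AB openE by blast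
  obtain b where b: "b > 0" "ball x' b \<subseteq> B" using AB openE by blast
  have "line v \<noteq> line v'" if "v \<in> ball x (min a b)" "v' \<in> ball x' (min a b)" for v v'
  proof -
    have "v \<in> A" "v' \<in> B" using that a(2) b(2) by auto
    then have "(v, v') \<in> S" using AB(5) by blast
    then show ?thesis using line_eq_minors[of v v' i j] by (auto simp: S_def)
  qed
  then show ?thesis using a(1) b(1) by (intro exI[of _ "min a b"]) auto
qed

lemma finite_lines_locally_distinct:
  fixes X :: "(complex ^ 'n::finite) set"
  assumes "finite X" and "0 \<notin> X" and "inj_on line X"
  obtains r where "r > 0"
    and "\<And>x x' v v'. x \<in> X \<Longrightarrow> x' \<in> X \<Longrightarrow> x \<noteq> x' \<Longrightarrow> v \<in> ball x r \<Longrightarrow> v' \<in> ball x' r \<Longrightarrow>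
      line v \<noteq> line v'"
proof -
  define D where "D = {(x, x'). x \<in> X \<and> x' \<in> X \<and> x \<noteq> x'}"
  have "finite D" by (rule finite_subset[of _ "X \<times> X"]) (use assms(1) in \<open>auto simp: D_def\<close>)
  have "\<forall>q\<in>D. \<exists>r>0. \<forall>v\<in>ball (fst q) r. \<forall>v'\<in>ball (snd q) r. line v \<noteq> line v'"
  proof
    fix q assume "q \<in> D"
    then show "\<exists>r>0. \<forall>v\<in>ball (fst q) r. \<forall>v'\<in>ball (snd q) r. line v \<noteq> line v'"
      using assms(2) inj_onD[OF assms(3)]
      by (intro lines_locally_distinct) (auto simp: D_def)
  qed
  from bchoice[OF this] obtain R where R: "\<forall>q\<in>D. R q > 0 \<and>
      (\<forall>v\<in>ball (fst q) (R q). \<forall>v'\<in>ball (snd q) (R q). line v \<noteq> line v')" by blast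
  \<comment> \<open>The 1 covers sets \<open>X\<close> with at most one element.\<close>
  define r where "r = Min (insert 1 (R ` D))"
  have "r > 0" unfolding r_def using \<open>finite D\<close> R by (subst Min_gr_iff) auto
  moreover have "line v \<noteq> line v'"
    if "x \<in> X" "x' \<in> X" "x \<noteq> x'" "v \<in> ball x r" "v' \<in> ball x' r" for x x' v v'
  proof -
    have q: "(x, x') \<in> D" using that by (simp add: D_def)
    then have "r \<le> R (x, x')" unfolding r_def using \<open>finite D\<close> by (intro Min_le) auto
    then have "v \<in> ball x (R (x, x'))" "v' \<in> ball x' (R (x, x'))" using that(4,5) by auto
    then show ?thesis using R q by fastforce
  qed
  ultimately show ?thesis by (rule that)
qed

section \<open>Deformations\<close>

text \<open>A finite index set common to all \<open>f s\<close>, in contrast to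
  \<open>keys (f s)\<close>, which may jump with \<open>s\<close>. Thanks to the constant degree,
  the gradients are sums over it with coefficients holomorphic in \<open>s\<close>.\<close>

definition exponents :: "nat \<Rightarrow> ('n::finite \<Rightarrow>\<^sub>0 nat) set" where
  "exponents d = {m. (\<Sum>i\<in>UNIV. Poly_Mapping.lookup m i) = d}"

lemma finite_exponents: "finite (exponents d :: ('n::finite \<Rightarrow>\<^sub>0 nat) set)"
proof (rule finite_subset)
  have "Poly_Mapping.lookup m i \<le> (\<Sum>i\<in>UNIV. Poly_Mapping.lookup m i)" for m :: "'n \<Rightarrow>\<^sub>0 nat" and i
    by (rule member_le_sum) auto
  then show "exponents d \<subseteq> {m :: 'n \<Rightarrow>\<^sub>0 nat. Poly_Mapping.lookup m \<in> exponent_box d}"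
    by (auto simp: exponents_def mem_exponent_box)
  show "finite {m :: 'n \<Rightarrow>\<^sub>0 nat. Poly_Mapping.lookup m \<in> exponent_box d}"
    using bij_betw_finite[OF bij_betw_lookup, of "exponent_box d :: ('n \<Rightarrow> nat) set"] by simp
qed

lemma partial_linear_combination:
  assumes "\<And>m. m \<in> M \<Longrightarrow> polyfun (p m)"
  shows "partial i (\<lambda>x. \<Sum>m\<in>M. c m * p m x) x = (\<Sum>m\<in>M. c m * partial i (p m) x)"
proof (rule partial_eqI)
  have "((\<lambda>x. \<Sum>m\<in>M. c m * p m x) has_derivative
      (\<lambda>h. \<Sum>m\<in>M. c m * (\<Sum>j\<in>UNIV. partial j (p m) x * h $ j))) (at x)"
    by (intro has_derivative_sum has_derivative_mult_right polyfun_has_derivative assms)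
  also have "(\<lambda>h. \<Sum>m\<in>M. c m * (\<Sum>j\<in>UNIV. partial j (p m) x * h $ j)) =
      (\<lambda>h. \<Sum>j\<in>UNIV. (\<Sum>m\<in>M. c m * partial j (p m) x) * h $ j)"
    by (rule ext) (simp add: sum_distrib_left sum_distrib_right mult_ac, rule sum.swap)
  finally show "((\<lambda>x. \<Sum>m\<in>M. c m * p m x) has_derivative
      (\<lambda>h. \<Sum>j\<in>UNIV. (\<Sum>m\<in>M. c m * partial j (p m) x) * h $ j)) (at x)" .
qed

lemma gradient_expand:
  assumes "homogeneous d f"
  shows "gradient f x $ i = (\<Sum>m\<in>exponents d.
    Poly_Mapping.lookup f m * partial i (monom_fun (Poly_Mapping.lookup m)) x)"
proof -
  have "cpoly_eval f = (\<lambda>x. \<Sum>m\<in>exponents d.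
      Poly_Mapping.lookup f m * monom_fun (Poly_Mapping.lookup m) x)"
    using assms
    by (intro ext cpoly_eval_superset finite_exponents) (auto simp: homogeneous_def exponents_def)
  then show ?thesis
    by (simp add: gradient_nth partial_linear_combination polyfun_monom)
qed

context
  fixes f :: "complex \<Rightarrow> 'n::finite cpoly" and d :: nat and D :: "complex set"
  assumes D: "open D" "0 \<in> D"
    and hom: "\<And>s. s \<in> D \<Longrightarrow> homogeneous d (f s)"
    and hol: "\<And>m. (\<lambda>s. Poly_Mapping.lookup (f s) m) holomorphic_on D"
begin

lemma gradient_continuous_in_parameter: "continuous_on D (\<lambda>s. gradient (f s) x $ i)"
proof -
  have "continuous_on D (\<lambda>s. \<Sum>m\<in>exponents d.
      Poly_Mapping.lookup (f s) m * partial i (monom_fun (Poly_Mapping.lookup m)) x)"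
    by (intro continuous_intros holomorphic_on_imp_continuous_on hol)
  then show ?thesis by (simp add: gradient_expand[OF hom] cong: continuous_on_cong)
qed

text \<open>Treating \<open>s\<close> as a further coordinate of source and target makes the
  neighbourhood of values uniform in \<open>s\<close>. The derivative of the extended map is block
  triangular, with the Jacobian of \<open>gradient (f 0)\<close> as its only nontrivial diagonal
  block.\<close>

lemma gradient_family_open_at:
  assumes det: "det (jacobian (gradient (f 0)) a) \<noteq> 0" and r: "r > 0"
  shows "eventually (\<lambda>(s, y). s \<in> D \<and> (\<exists>x\<in>ball a r. gradient (f s) x = y))
    (nhds (0, gradient (f 0) a))"
proof -
  define c where "c m s = Poly_Mapping.lookup (f s) m" for m s
  define q where "q m i = partial i (monom_fun (Poly_Mapping.lookup m))"
    for m :: "'n \<Rightarrow>\<^sub>0 nat" and i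
  have q: "polyfun (q m i)" for m i
    unfolding q_def by (intro polyfun_partial polyfun_monom)
  \<comment> \<open>Agrees with the gradient for \<open>s \<in> D\<close>, where homogeneity is
    known.\<close>
  define \<Psi> where "\<Psi> p = (\<chi> i. \<Sum>m\<in>exponents d. c m (fst p) * q m i (snd p))"
    for p :: "complex \<times> (complex ^ 'n)"
  have \<Psi>: "\<Psi> (s, x) = gradient (f s) x" if "s \<in> D" for s x
    by (simp add: \<Psi>_def vec_eq_iff gradient_expand[OF hom[OF that]] c_def q_def)
  define c' where "c' m = deriv (c m) 0" for m
  have c': "(c m has_derivative (*) (c' m)) (at 0)" for m
    using holomorphic_derivI[OF hol D] unfolding c'_def c_def has_field_derivative_def by blast
  \<comment> \<open>The derivative of \<open>gradient (f s) a\<close> in the parameter at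
    \<open>s = 0\<close>.\<close>
  define w where "w = (\<chi> i. \<Sum>m\<in>exponents d. c' m * q m i a)"
  define A where "A = jacobian (gradient (f 0)) a"
  have A: "A $ i $ l = (\<Sum>m\<in>exponents d. c m 0 * partial l (q m i) a)" for i l
    unfolding A_def jacobian_def
    by (simp add: gradient_expand[OF hom[OF D(2)]] c_def[symmetric] q_def[symmetric]
        partial_linear_combination q)
  have D\<Psi>: "(\<Psi> has_derivative (\<lambda>h. fst h *s w + A *v snd h)) (at (0, a))"
  proof (rule has_derivative_cart)
    fix i
    have d1: "((\<lambda>p. c m (fst p)) has_derivative (\<lambda>h. c' m * fst h)) (at (0, a))" for m
      by (rule has_derivative_compose[OF has_derivative_fst[OF has_derivative_ident]])
        (simp add: c')
    have d2: "((\<lambda>p. q m i (snd p)) has_derivative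
        (\<lambda>h. \<Sum>l\<in>UNIV. partial l (q m i) a * snd h $ l)) (at (0, a))" for m
      by (rule has_derivative_compose[OF has_derivative_snd[OF has_derivative_ident]])
        (simp add: polyfun_has_derivative[OF q])
    have "((\<lambda>p. c m (fst p) * q m i (snd p)) has_derivative
        (\<lambda>h. c m 0 * (\<Sum>l\<in>UNIV. partial l (q m i) a * snd h $ l)
          + c' m * fst h * q m i a)) (at (0, a))" for m
      using has_derivative_mult[OF d1[of m] d2[of m]] by simp
    then have "((\<lambda>p. \<Sum>m\<in>exponents d. c m (fst p) * q m i (snd p)) has_derivative
        (\<lambda>h. \<Sum>m\<in>exponents d. c m 0 * (\<Sum>l\<in>UNIV. partial l (q m i) a * snd h $ l)
          + c' m * fst h * q m i a)) (at (0, a))"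
      by (intro has_derivative_sum)
    moreover have "(\<Sum>m\<in>exponents d. c m 0 * (\<Sum>l\<in>UNIV. partial l (q m i) a * snd h $ l)
          + c' m * fst h * q m i a) = (fst h *s w + A *v snd h) $ i" for h :: "complex \<times> (complex ^ 'n)"
    proof -
      have "(A *v snd h) $ i
          = (\<Sum>l\<in>UNIV. \<Sum>m\<in>exponents d. c m 0 * (partial l (q m i) a * snd h $ l))"
        by (simp add: matrix_vector_mult_def A sum_distrib_right mult.assoc)
      also have "\<dots> = (\<Sum>m\<in>exponents d. c m 0 * (\<Sum>l\<in>UNIV. partial l (q m i) a * snd h $ l))"
        by (subst sum.swap) (simp add: sum_distrib_left)
      finally show ?thesis
        by (simp add: w_def sum.distrib sum_distrib_left mult_ac)
    qed
    ultimately show "((\<lambda>p. \<Psi> p $ i) has_derivative (\<lambda>h. (fst h *s w + A *v snd h) $ i)) (at (0, a))"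
      by (simp add: \<Psi>_def)
  qed
  define \<Phi> where "\<Phi> p = (fst p, \<Psi> p)" for p
  have D\<Phi>: "(\<Phi> has_derivative (\<lambda>h. (fst h, fst h *s w + A *v snd h))) (at (0, a))"
    unfolding \<Phi>_def by (intro has_derivative_Pair has_derivative_fst has_derivative_ident D\<Psi>)
  obtain B where B: "A ** B = mat 1"
    using det by (auto simp: A_def invertible_det_nz[symmetric] invertible_def)
  \<comment> \<open>A right inverse of the triangular derivative: the parameter is read off, its
    contribution \<open>w\<close> is subtracted, and \<open>B\<close> inverts the rest.\<close>
  have lin: "bounded_linear (\<lambda>k. (fst k, B *v (snd k - fst k *s w)))"
  proof -
    have "bounded_linear (\<lambda>t. t *s w)"
      by (simp add: linear_conv_bounded_linear[symmetric] linear_iff vec_eq_iff algebra_simps)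
    then show ?thesis
      by (intro bounded_linear_Pair bounded_linear_fst bounded_linear_sub bounded_linear_snd
          bounded_linear_compose[OF bounded_linear_matrix_vector_mult]
          bounded_linear_compose[OF _ bounded_linear_fst])
  qed
  have inv: "(\<lambda>h. (fst h, fst h *s w + A *v snd h)) \<circ> (\<lambda>k. (fst k, B *v (snd k - fst k *s w))) = id"
    by (simp add: fun_eq_iff matrix_vector_mul_assoc B)
  have "continuous_on (D \<times> UNIV) (\<lambda>p. c m (fst p))" for m
    using holomorphic_on_imp_continuous_on[OF hol[of m]] unfolding c_def
    by (rule continuous_on_compose2[OF _ continuous_on_fst[OF continuous_on_id]]) auto
  moreover have "continuous_on (D \<times> UNIV) (\<lambda>p. q m i (snd p))" for m i
    using polyfun_continuous[OF q, of UNIV]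
    by (rule continuous_on_compose2[OF _ continuous_on_snd[OF continuous_on_id]]) auto
  ultimately have cont: "continuous_on (D \<times> UNIV) \<Phi>"
    unfolding \<Phi>_def \<Psi>_def
    by (intro continuous_on_Pair continuous_on_fst continuous_on_id continuous_on_vec_lambda
        continuous_on_sum continuous_on_mult)
  have "open (D \<times> ball a r)" using D(1) by (intro open_Times) auto
  then have "\<Phi> (0, a) \<in> interior (\<Phi> ` (D \<times> ball a r))"
    using D r
    by (intro sussmann_open_mapping[OF _ cont _ D\<Phi> lin inv])
      (auto simp: interior_open intro: open_Times)
  moreover have "\<Phi> (0, a) = (0, gradient (f 0) a)" using \<Psi>[OF D(2)] by (simp add: \<Phi>_def)
  ultimately have "eventually (\<lambda>u. u \<in> interior (\<Phi> ` (D \<times> ball a r))) (nhds (0, gradient (f 0) a))"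
    by (intro eventually_nhds_in_open) auto
  then show ?thesis
  proof (rule eventually_mono)
    fix u assume "u \<in> interior (\<Phi> ` (D \<times> ball a r))"
    then obtain s x where "s \<in> D" "x \<in> ball a r" "u = \<Phi> (s, x)"
      using interior_subset by blast
    then show "case u of (s, y) \<Rightarrow> s \<in> D \<and> (\<exists>x\<in>ball a r. gradient (f s) x = y)"
      by (auto simp: \<Phi>_def \<Psi>)
  qed
qed

end

section \<open>The polar degree in degrees 0 and 1\<close>

lemma polar_degree_eq_0I:
  assumes "for_general_point (\<lambda>q. grad_fibre f q = {})"
  shows "polar_degree f = 0"
  using assms by (intro polar_degree_eqI) (auto simp: for_general_point_def)

lemma homogeneous_0_polar_degree:
  assumes "homogeneous 0 f"
  shows "polar_degree (f :: 'n::finite cpoly) = 0"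
proof -
  have "cpoly_eval f x = cpoly_eval f 0" for x
    using cpoly_eval_scale[OF assms, of 0 x] by simp
  then obtain c where "cpoly_eval f = (\<lambda>_. c)" by blast
  then have "gradient f x = 0" for x by (simp add: gradient_def vec_eq_iff)
  then have "grad_fibre f q = {}" for q by (auto simp: grad_fibre_def Sing_def)
  then have "for_general_point (\<lambda>q. grad_fibre f q = {})"
    unfolding for_general_point_iff by (auto intro!: exI[of _ "\<lambda>_. 1"] polyfun.const)
  then show ?thesis by (rule polar_degree_eq_0I)
qed

context
  fixes f :: "'n::finite cpoly"
  assumes hom: "homogeneous 1 f"
begin

lemma gradient_linear_form: "gradient f x = gradient f 0"
  using gradient_scale[of 0 f 0 x] hom by simp

lemma grad_fibre_linear_form:
  "grad_fibre f q = (if gradient f 0 \<noteq> 0 \<and> q = line (gradient f 0) then proj_space else {})"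
proof -
  define a where "a = gradient f 0"
  have a: "gradient f x = a" for x unfolding a_def by (rule gradient_linear_form)
  have "grad_map f p = line a \<and> (p \<in> Sing f \<longleftrightarrow> a = 0)" if p: "p \<in> proj_space" for p
  proof -
    obtain x where x: "x \<in> p" "x \<noteq> 0"
      using p vec.span_base by (force simp: proj_space_def)
    then have "gradient f ` p = {a}" by (auto simp: a)
    then show ?thesis using x p by (auto simp: grad_map_def Sing_def a)
  qed
  then have "grad_fibre f q = (if a \<noteq> 0 \<and> q = line a then proj_space else {})"
    unfolding grad_fibre_def by auto
  then show ?thesis by (simp only: a_def)
qed

lemma linear_form_polar_degree_0:
  assumes "gradient f 0 = 0 \<or> (\<exists>y. y \<noteq> 0 \<and> line y \<noteq> line (gradient f 0))"
  shows "polar_degree f = 0"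
proof (rule polar_degree_eq_0I)
  let ?a = "gradient f 0"
  show "for_general_point (\<lambda>q. grad_fibre f q = {})"
  proof (cases "?a = 0")
    case True
    then show ?thesis
      unfolding for_general_point_iff grad_fibre_linear_form
      by (auto intro!: exI[of _ "\<lambda>_. 1"] polyfun.const)
  next
    case False
    then obtain y where "y \<noteq> 0" "line y \<noteq> line ?a" using assms by blast
    then obtain i j where "y $ i * ?a $ j \<noteq> y $ j * ?a $ i" using line_neq_minor False by blast
    then have "y $ i * ?a $ j + y $ j * (- ?a $ i) \<noteq> 0" by simp
    moreover have "polyfun (\<lambda>y. y $ i * ?a $ j + y $ j * (- ?a $ i))" by (intro polyfun.intros)
    moreover have "line v \<noteq> line ?a" if "v $ i * ?a $ j + v $ j * (- ?a $ i) \<noteq> 0" for v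
      using line_eq_minors[of v ?a i j] that by auto
    ultimately show ?thesis
      unfolding for_general_point_iff grad_fibre_linear_form
      by (intro exI[of _ "\<lambda>y. y $ i * ?a $ j + y $ j * (- ?a $ i)"]) auto
  qed
qed

text \<open>The second assumption means that projective space is a single point; a nonzero linear
  form maps it bijectively to itself.\<close>

lemma linear_form_polar_degree_1:
  assumes "gradient f 0 \<noteq> 0" and "\<And>y. y \<noteq> 0 \<Longrightarrow> line y = line (gradient f 0)"
  shows "polar_degree f = 1"
proof (rule polar_degree_eqI)
  define L where "L = line (gradient f 0)"
  have all: "line y = L" if "y \<noteq> 0" for y unfolding L_def using assms(2) that .
  have "p = L" if "p \<in> proj_space" for p using that all by (auto simp: proj_space_def)
  moreover have "L \<in> proj_space" using assms(1) by (auto simp: proj_space_def L_def)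
  ultimately have "proj_space = {L}" by blast
  then have "grad_fibre f (line y) = {L}" if "y \<noteq> 0" for y
    using all[OF that] assms(1) by (simp add: grad_fibre_linear_form L_def)
  then show "for_general_point (\<lambda>q. finite (grad_fibre f q) \<and> card (grad_fibre f q) = 1)"
    unfolding for_general_point_iff by (intro exI[of _ "\<lambda>_. 1"]) (simp add: polyfun.const)
qed

end

theorem proposition4p1:
  fixes f :: "complex \<Rightarrow> 'n::finite cpoly" and d :: nat and D :: "complex set"
  assumes "open D" and "0 \<in> D"
    and "\<And>s. s \<in> D \<Longrightarrow> homogeneous d (f s)"
    and "\<And>m. (\<lambda>s. Poly_Mapping.lookup (f s) m) holomorphic_on D"
  shows "eventually (\<lambda>s. polar_degree (f s) \<ge> polar_degree (f 0)) (nhds 0)"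
proof -
  consider "d = 0" | "d = 1" | e where "d = Suc e" "e > 0"
    by (metis One_nat_def gr0I not0_implies_Suc)
  then show ?thesis
  proof cases
    case 1
    then have "polar_degree (f 0) = 0" using homogeneous_0_polar_degree assms by blast
    then show ?thesis by simp
  next
    case 2
    then have hom: "\<And>s. s \<in> D \<Longrightarrow> homogeneous 1 (f s)" using assms(3) by simp
    show ?thesis
    proof (cases "gradient (f 0) 0 = 0 \<or> (\<exists>y. y \<noteq> 0 \<and> line y \<noteq> line (gradient (f 0) 0))")
      case True
      then have "polar_degree (f 0) = 0"
        using linear_form_polar_degree_0[OF hom[OF assms(2)]] by blast
      then show ?thesis by simp
    next
      \<comment> \<open>Projective space is a point and \<open>f 0\<close> has nonzero gradient. By
        continuity this persists, and both polar degrees are 1.\<close>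
      case False
      then obtain i where i: "gradient (f 0) 0 $ i \<noteq> 0" by (auto simp: vec_eq_iff)
      have "continuous_on D (\<lambda>s. gradient (f s) 0 $ i)"
        by (rule gradient_continuous_in_parameter[OF assms])
      then have "isCont (\<lambda>s. gradient (f s) 0 $ i) 0"
        using assms(1,2) continuous_on_eq_continuous_at by blast
      then have "((\<lambda>s. gradient (f s) 0 $ i) \<longlongrightarrow> gradient (f 0) 0 $ i) (nhds 0)"
        by (simp add: isCont_def tendsto_nhds_iff)
      then have "eventually (\<lambda>s. gradient (f s) 0 $ i \<noteq> 0) (nhds 0)"
        using i by (rule tendsto_imp_eventually_ne)
      moreover have "eventually (\<lambda>s. s \<in> D) (nhds 0)"
        using assms(1,2) by (rule eventually_nhds_in_open)
      ultimately show ?thesis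
      proof eventually_elim
        case (elim s)
        then have a: "gradient (f s) 0 \<noteq> 0" by auto
        have "line y = line (gradient (f s) 0)" if "y \<noteq> 0" for y using False a that by metis
        then have "polar_degree (f s) = 1"
          using linear_form_polar_degree_1[OF hom[OF elim(2)] a] by blast
        moreover have "polar_degree (f 0) = 1"
          using linear_form_polar_degree_1[OF hom[OF assms(2)]] False by blast
        ultimately show ?case by simp
      qed
    qed
  next
    case (3 e)
    then have hom: "\<And>s. s \<in> D \<Longrightarrow> homogeneous (Suc e) (f s)" using assms(3) by simp
    let ?G = "\<lambda>s. gradient (f s)"
    obtain z y where z: "proper_locus (?G 0) z" "z y \<noteq> 0" "y \<noteq> 0"
      using proper_locus_point[OF hom[OF assms(2)] 3(2)] by blast
    let ?F = "{x. ?G 0 x = y}"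
    let ?P = "grad_fibre (f 0) (line y)"
    have P: "polar_degree (f 0) = card ?P" "?P = line ` ?F"
      using polar_degree_proper_locus(1)[OF hom[OF assms(2)] 3(2) z]
        grad_fibre_line[OF hom[OF assms(2)] 3(2) z(3)] by auto
    \<comment> \<open>One vector for each line of the projective fibre; the \<open>e\<close> vectors
      on a line count only once.\<close>
    obtain X where X: "X \<subseteq> ?F" "inj_on line X" "line ` X = ?P"
      using subset_image_inj[of ?P line ?F] P(2) by auto
    have fin: "finite X" using X(1) z by (auto simp: proper_locus_def intro: finite_subset)
    have "0 \<notin> X" using X(1) gradient_0[OF hom[OF assms(2)] 3(2)] z(3) by auto
    then obtain r where r: "r > 0" "\<And>x x' v v'. x \<in> X \<Longrightarrow> x' \<in> X \<Longrightarrow> x \<noteq> x' \<Longrightarrow>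
        v \<in> ball x r \<Longrightarrow> v' \<in> ball x' r \<Longrightarrow> line v \<noteq> line v'"
      using finite_lines_locally_distinct[OF fin _ X(2)] by metis
    have "eventually (\<lambda>u. \<forall>x\<in>X. case u of (s, w) \<Rightarrow> s \<in> D \<and> (\<exists>v\<in>ball x r. ?G s v = w)) (nhds (0, y))"
    proof (rule eventually_ball_finite[OF fin], rule ballI)
      fix x assume "x \<in> X"
      then have "?G 0 x = y" using X(1) by auto
      moreover have "det (jacobian (?G 0) x) \<noteq> 0" using calculation z by (auto simp: proper_locus_def)
      ultimately show "eventually (\<lambda>(s, w). s \<in> D \<and> (\<exists>v\<in>ball x r. ?G s v = w)) (nhds (0, y))"
        using gradient_family_open_at[OF assms _ r(1), of x] by simp
    qed
    then obtain N where N: "open N" "(0, y) \<in> N"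
      "\<And>s w x. (s, w) \<in> N \<Longrightarrow> x \<in> X \<Longrightarrow> \<exists>v\<in>ball x r. ?G s v = w"
      unfolding eventually_nhds by fastforce
    \<comment> \<open>A product neighbourhood makes the set \<open>W\<close> of admissible values
      independent of \<open>s\<close>.\<close>
    obtain S W where SW: "open S" "open W" "0 \<in> S" "y \<in> W" "S \<times> W \<subseteq> N"
      using N(1,2) by (rule open_prod_elim) auto
    have "eventually (\<lambda>s. s \<in> S \<inter> D) (nhds 0)"
      using SW(1,3) assms(1,2) by (intro eventually_nhds_in_open) auto
    then show ?thesis
    proof eventually_elim
      case (elim s)
      then have hs: "homogeneous (Suc e) (f s)" using hom by blast
      \<comment> \<open>\<open>y\<close> need not be general for \<open>f s\<close>, but
        \<open>W\<close> contains a general \<open>w\<close>, and near every point of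
        \<open>X\<close> there is still a vector with gradient \<open>w\<close>.\<close>
      obtain w where w: "w \<in> W" "w \<noteq> 0" "finite (grad_fibre (f s) (line w))"
        "card (grad_fibre (f s) (line w)) = polar_degree (f s)"
        using for_general_point_in_open[OF general_fibre_card[OF hs 3(2)] SW(2,4)] by blast
      have "\<forall>x\<in>X. \<exists>v. v \<in> ball x r \<and> ?G s v = w"
        using N(3) SW(5) w(1) elim by blast
      from bchoice[OF this] obtain v where v: "\<forall>x\<in>X. v x \<in> ball x r \<and> ?G s (v x) = w" by blast
      have "inj_on (\<lambda>x. line (v x)) X"
        using r(2) v unfolding inj_on_def by metis
      moreover have "(\<lambda>x. line (v x)) ` X \<subseteq> grad_fibre (f s) (line w)"
        unfolding grad_fibre_line[OF hs 3(2) w(2)] using v by auto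
      ultimately have "card X \<le> polar_degree (f s)"
        using card_inj_on_le w(3,4) by metis
      moreover have "card X = polar_degree (f 0)" using card_image[OF X(2)] X(3) P(1) by simp
      ultimately show ?case by simp
    qed
  qed
qed

end
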